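(* For every triangle-free, bridgeless, outerplanar graph $G$, we have $\vec{\chi}(G)\leq 4$.
   Context: All graphs are finite, without loops or multiple edges. An orientation of a graph $G$ is a digraph obtained from $G$ by replacing each edge by exactly one of the two possible arcs with the same end-vertices. For an orientation $D$ and vertex $v$, $d^-_D(v)$ denotes the in-degree of $v$ in $D$. An orientation $D$ of $G$ is proper if $d^-_D(u)\neq d^-_D(v)$ for every edge $uv$ of $G$. The proper orientation number $\vec{\chi}(G)$ is the minimum integer $k$ such that $G$ has a proper orientation with maximum in-degree at most $k$. A graph is outerplanar if it has a planar embedding in which all vertices lie on the boundary of a single face. A bridge is an edge whose deletion increases the number of connected components; a graph is bridgeless if it has no bridges. *)

theory Defs
  imports "HOL-Analysis.Analysis" "Graph_Theory.Digraph_Component"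
begin

text \<open>
  A finite simple graph is a \<^locale>\<open>pair_graph\<close>: a finite loop-free symmetric digraph whose
  arcs are ordered pairs, an undirected edge \<open>uv\<close> being the pair of arcs \<open>(u, v)\<close>, \<open>(v, u)\<close>.
\<close>

definition uedges :: "'a pair_pre_digraph \<Rightarrow> 'a set set" where
  "uedges G = {{u, v} | u v. (u, v) \<in> parcs G}"

definition orientation :: "'a pair_pre_digraph \<Rightarrow> 'a pair_pre_digraph \<Rightarrow> bool" where
  "orientation D G \<longleftrightarrow> pverts D = pverts G \<and> parcs D \<subseteq> parcs G \<and>
     (\<forall>(u, v) \<in> parcs G. (u, v) \<in> parcs D \<longleftrightarrow> (v, u) \<notin> parcs D)"

definition proper_orientation :: "'a pair_pre_digraph \<Rightarrow> 'a pair_pre_digraph \<Rightarrow> bool" where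
  "proper_orientation D G \<longleftrightarrow> orientation D G \<and>
     (\<forall>(u, v) \<in> parcs G. in_degree (with_proj D) u \<noteq> in_degree (with_proj D) v)"

text \<open>
  The minimum is over a nonempty set: repeatedly choosing a vertex of maximum degree, orienting
  all its remaining edges towards it and deleting it yields a proper orientation.
\<close>

definition proper_orientation_number :: "'a pair_pre_digraph \<Rightarrow> nat" where
  "proper_orientation_number G = (LEAST k. \<exists>D. proper_orientation D G \<and>
     (\<forall>v \<in> pverts G. in_degree (with_proj D) v \<le> k))"

definition triangle_free :: "'a pair_pre_digraph \<Rightarrow> bool" where
  "triangle_free G \<longleftrightarrow>
     \<not> (\<exists>u v w. (u, v) \<in> parcs G \<and> (v, w) \<in> parcs G \<and> (w, u) \<in> parcs G)"

definition delete_edge :: "'a pair_pre_digraph \<Rightarrow> 'a \<Rightarrow> 'a \<Rightarrow> 'a pair_pre_digraph" where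
  "delete_edge G u v = \<lparr>pverts = pverts G, parcs = parcs G - {(u, v), (v, u)}\<rparr>"

text \<open>The strongly connected components of a symmetric digraph are its connected components.\<close>

definition num_components :: "'a pair_pre_digraph \<Rightarrow> nat" where
  "num_components G = card (pre_digraph.sccs_verts (with_proj G))"

definition bridge :: "'a pair_pre_digraph \<Rightarrow> 'a \<Rightarrow> 'a \<Rightarrow> bool" where
  "bridge G u v \<longleftrightarrow> (u, v) \<in> parcs G \<and> num_components G < num_components (delete_edge G u v)"

definition bridgeless :: "'a pair_pre_digraph \<Rightarrow> bool" where
  "bridgeless G \<longleftrightarrow> \<not> (\<exists>u v. bridge G u v)"

text \<open>
  A planar embedding places vertex \<open>v\<close> at the point \<open>p v\<close> of the plane and draws the edge \<open>e\<close> as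
  the simple arc \<open>\<gamma> e\<close> joining its end-vertices; arcs meet vertices and other arcs only at
  common end-vertices.
\<close>

definition planar_embedding ::
    "'a pair_pre_digraph \<Rightarrow> ('a \<Rightarrow> complex) \<Rightarrow> ('a set \<Rightarrow> real \<Rightarrow> complex) \<Rightarrow> bool" where
  "planar_embedding G p \<gamma> \<longleftrightarrow>
     inj_on p (pverts G) \<and>
     (\<forall>e \<in> uedges G. arc (\<gamma> e) \<and> {pathstart (\<gamma> e), pathfinish (\<gamma> e)} = p ` e \<and>
        path_image (\<gamma> e) \<inter> p ` pverts G = p ` e) \<and>
     (\<forall>e \<in> uedges G. \<forall>f \<in> uedges G. e \<noteq> f \<longrightarrow>
        path_image (\<gamma> e) \<inter> path_image (\<gamma> f) \<subseteq> p ` (e \<inter> f))"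

definition drawing ::
    "'a pair_pre_digraph \<Rightarrow> ('a \<Rightarrow> complex) \<Rightarrow> ('a set \<Rightarrow> real \<Rightarrow> complex) \<Rightarrow> complex set" where
  "drawing G p \<gamma> = p ` pverts G \<union> (\<Union>e \<in> uedges G. path_image (\<gamma> e))"

definition faces ::
    "'a pair_pre_digraph \<Rightarrow> ('a \<Rightarrow> complex) \<Rightarrow> ('a set \<Rightarrow> real \<Rightarrow> complex) \<Rightarrow> complex set set" where
  "faces G p \<gamma> = components (- drawing G p \<gamma>)"

definition outerplanar :: "'a pair_pre_digraph \<Rightarrow> bool" where
  "outerplanar G \<longleftrightarrow> (\<exists>p \<gamma>. planar_embedding G p \<gamma> \<and>
     (\<exists>F \<in> faces G p \<gamma>. p ` pverts G \<subseteq> frontier F))"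

end

theory Submission
  imports Defs
begin

text \<open>
  In an outerplanar graph two vertices cannot be joined by three internally disjoint paths that all
  have an interior vertex: every face of a theta curve misses the interior of one of its arcs.
  A triangle-free bridgeless graph without such a theta shrinks to nothing by removing isolated
  vertices and ears, an ear being a path of vertices of degree two whose ends are either adjacent
  (and then still lie on a common cycle after the removal) or equal.

  Orient the graph by putting the ears back. The difficult ears are those whose ends have
  the in-degrees 1 and 2, or coincide in a vertex of in-degree 2. Hence the vertex or edge that will carry
  an ear is marked beforehand, and in-degrees are assigned while counting in advance the arcs which
  the ear is promised to send into its ends. A finite table of promises can be kept for every ear,
  whatever marks its own vertices and edges carry. By theta-freeness an edge never carries a second mark.
\<close>

text \<open>A finished orientation of the smaller graph cannot simply be kept. Suppose an ear with
  three interior vertices is to be added between ends of in-degrees 1 and 2, and none of its arcs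
  enters an end: its first interior vertex must get in-degree 2, its last one 1, and then the middle
  one also gets 1. An arc sent into an end afterwards could clash at other neighbours of that end.
  So the smaller graph is solved with a mark in place of the ear, and its in-degrees already contain
  what the ear will deliver, whatever its length and its own marks. Those marks are imposed from
  outside, hence the labels of an ear are found by a subset construction: for each pattern of marks
  the set of reachable states is followed along the ear. Finitely many patterns decide, since after
  four interior vertices every state that the last edge allows is reachable. Vertices, unlike edges,
  may be marked repeatedly: all ears with both ends at a vertex, except the one removed first, then
  send no arcs into it.\<close>

section \<open>Faces of theta curves\<close>

lemma connected_subset_inside:
  fixes S X :: "complex set"
  assumes "closed S" "topological_space_class.connected X" "X \<inter> S = {}" "X \<inter> inside S \<noteq> {}"
  shows "X \<subseteq> inside S"
proof -
  have "X \<subseteq> inside S \<union> outside S" using assms(3) union_with_inside[of S] by (auto simp: inside_Un_outside)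
  moreover have "inside S \<inter> outside S \<inter> X = {}" by (simp add: inside_Int_outside)
  ultimately have "outside S \<inter> X = {}"
    using connectedD[OF assms(2) open_inside[OF assms(1)] open_outside[OF assms(1)]] assms(4)
    by (auto simp: Int_commute)
  then show ?thesis using \<open>X \<subseteq> inside S \<union> outside S\<close> by blast
qed

text \<open>The Jordan curve theorem for the closed curve that follows \<open>g\<close> and returns
  along \<open>h\<close>; it serves all three cycles of a theta curve.\<close>

lemma two_arcs_Jordan:
  fixes g h :: "real \<Rightarrow> complex"
  assumes "arc g" "arc h" "pathstart g = a" "pathfinish g = b" "pathstart h = a" "pathfinish h = b"
    and "path_image g \<inter> path_image h = {a, b}"
  defines "J \<equiv> path_image g \<union> path_image h"
  shows "closed J" "compact J" "inside J \<noteq> {}" "topological_space_class.connected (inside J)" "topological_space_class.connected (outside J)" "bounded (inside J)"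
    "inside J \<union> outside J = - J" "frontier (inside J) = J" "frontier (outside J) = J"
proof -
  define c where "c = g +++ reversepath h"
  have ends: "pathfinish g = pathstart (reversepath h)" "pathstart g = pathfinish (reversepath h)" using assms by auto
  have c: "simple_path c" "pathfinish c = pathstart c" "path_image c = J"
    using assms ends unfolding c_def J_def
    by (auto simp: simple_path_join_loop_eq arc_reversepath path_image_join)
  show "closed J" "compact J"
    unfolding J_def using assms(1,2) by (auto simp: compact_Un closed_Un compact_arc_image closed_arc_image)
  show "inside J \<noteq> {}" "topological_space_class.connected (inside J)" "topological_space_class.connected (outside J)" "bounded (inside J)"
    "inside J \<union> outside J = - J" "frontier (inside J) = J" "frontier (outside J) = J"
    using Jordan_inside_outside[OF c(1,2)] unfolding c(3) by auto
qed

locale theta_curve =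
  fixes g h k :: "real \<Rightarrow> complex" and a b :: complex
  assumes arcs: "arc g" "arc h" "arc k"
    and ends: "pathstart g = a" "pathfinish g = b" "pathstart h = a" "pathfinish h = b"
      "pathstart k = a" "pathfinish k = b"
    and disjoint: "path_image g \<inter> path_image h = {a, b}" "path_image g \<inter> path_image k = {a, b}"
      "path_image h \<inter> path_image k = {a, b}"
begin

lemma rotate: "theta_curve h k g a b"
  using arcs ends disjoint by unfold_locales auto

lemma distinct_ends: "a \<noteq> b"
  using arcs(1) ends(1,2) arc_distinct_ends by force

abbreviation "GH \<equiv> path_image g \<union> path_image h"
abbreviation "GK \<equiv> path_image g \<union> path_image k"
abbreviation "HK \<equiv> path_image h \<union> path_image k"

lemmas GH = two_arcs_Jordan[OF arcs(1,2) ends(1-4) disjoint(1)]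
lemmas GK = two_arcs_Jordan[OF arcs(1,3) ends(1,2,5,6) disjoint(2)]
lemmas HK = two_arcs_Jordan[OF arcs(2,3) ends(3-6) disjoint(3)]

text \<open>If \<open>F\<close> met \<open>inside GH\<close>, it would lie in it, and
  \<open>k\<close> would enter it too, as \<open>closure F\<close> touches the open arc
  \<open>k\<close>. But \<open>k\<close> cuts \<open>inside GH\<close> into \<open>inside GK\<close>
  and \<open>inside HK\<close>. \<open>F\<close> lies in one of the two, so its closure cannot reach
  the remaining open arc \<open>h\<close> or \<open>g\<close>, which is on
  \<open>GH\<close>.\<close>

lemma face_outside:
  assumes F: "topological_space_class.connected F" "F \<inter> (path_image g \<union> path_image h \<union> path_image k) = {}"
    and g: "closure F \<inter> (path_image g - {a, b}) \<noteq> {}"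
    and h: "closure F \<inter> (path_image h - {a, b}) \<noteq> {}"
    and k: "closure F \<inter> (path_image k - {a, b}) \<noteq> {}"
  shows "F \<inter> inside GH = {}"
proof (rule ccontr)
  assume meets: "F \<inter> inside GH \<noteq> {}"
  then have sub: "F \<subseteq> inside GH"
    using F GH(1) by (intro connected_subset_inside) auto
  have cl: "closure (inside GH) = inside GH \<union> GH" "closure (inside GK) = inside GK \<union> GK"
      "closure (inside HK) = inside HK \<union> HK"
    using GH(8) GK(8) HK(8) closure_Un_frontier by metis+
  have "closure F \<subseteq> inside GH \<union> GH" using closure_mono[OF sub] cl by simp
  then have "path_image k \<inter> inside GH \<noteq> {}" using k disjoint by blast
  then obtain 1: "inside GK \<inter> inside HK = {}"
    and 2: "inside GK \<union> inside HK \<union> (path_image k - {a, b}) = inside GH"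
    using split_inside_simple_closed_curve[of g a b h k] arcs ends disjoint distinct_ends
    by (metis arc_imp_simple_path)
  consider "F \<inter> inside GK \<noteq> {}" | "F \<inter> inside HK \<noteq> {}" using sub meets 2 F(2) by blast
  then show False
  proof cases
    case 1
    then have "F \<subseteq> inside GK" using F GK(1) by (intro connected_subset_inside) auto
    then have "closure F \<subseteq> inside GK \<union> GK" using closure_mono cl by metis
    then have "path_image h \<inter> inside GK \<noteq> {}" using h disjoint by blast
    then show False using 2 inside_no_overlap[of GH] by blast
  next
    case 2
    then have "F \<subseteq> inside HK" using F HK(1) by (intro connected_subset_inside) auto
    then have "closure F \<subseteq> inside HK \<union> HK" using closure_mono cl by metis
    then have "path_image g \<inter> inside HK \<noteq> {}" using g disjoint by blast
    then show False using \<open>inside GK \<union> inside HK \<union> (path_image k - {a, b}) = inside GH\<close>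
        inside_no_overlap[of GH] by blast
  qed
qed

text \<open>The open arc \<open>k\<close> is connected and misses \<open>GH\<close>, so one point of
  it outside \<open>GH\<close> decides for the whole; \<open>closure F\<close> supplies this
  point.\<close>

lemma arc_outside:
  assumes "F \<subseteq> outside GH" and k: "closure F \<inter> (path_image k - {a, b}) \<noteq> {}"
  shows "path_image k - {a, b} \<subseteq> outside GH"
proof -
  have conn: "topological_space_class.connected (path_image k - {a, b})"
    using connected_simple_path_endless[OF arc_imp_simple_path[OF arcs(3)]] ends(5,6) by simp
  have "closure F \<subseteq> outside GH \<union> GH"
    using closure_mono[OF assms(1)] GH(9) closure_Un_frontier by metis
  moreover have *: "(path_image k - {a, b}) \<inter> GH = {}" using disjoint by auto
  ultimately have "(path_image k - {a, b}) \<inter> outside GH \<noteq> {}"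
    using k by blast
  then have "\<not> path_image k - {a, b} \<subseteq> inside GH"
    using inside_Int_outside[of GH] by blast
  then have "(path_image k - {a, b}) \<inter> inside GH = {}"
    using connected_subset_inside[OF GH(1) conn *] by blast
  then show ?thesis using GH(7) * by blast
qed

text \<open>If the insides met, then \<open>inside GH\<close>, which \<open>GK\<close> does not
  enter, would be part of \<open>inside GK\<close>. Its closure contains \<open>h\<close>, so the
  open arc \<open>h\<close> would run inside \<open>GK\<close>.\<close>

lemma insides_disjoint:
  assumes "path_image k - {a, b} \<subseteq> outside GH" "path_image h - {a, b} \<subseteq> outside GK"
  shows "inside GH \<inter> inside GK = {}"
proof (rule ccontr)
  assume *: "inside GH \<inter> inside GK \<noteq> {}"
  have "inside GH \<inter> GK = {}"
    using assms(1) inside_no_overlap[of GH] inside_Int_outside[of GH] disjoint by blast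
  then have "inside GH \<subseteq> inside GK"
    using * GH(4) GK(1) by (intro connected_subset_inside) auto
  then have "closure (inside GH) \<subseteq> inside GK \<union> GK"
    using closure_mono GK(8) closure_Un_frontier by metis
  then have "GH \<subseteq> inside GK \<union> GK"
    using GH(8) closure_Un_frontier[of "inside GH"] by auto
  then have "path_image h - {a, b} \<subseteq> inside GK" using disjoint by blast
  then have "path_image h - {a, b} = {}"
    using assms(2) inside_Int_outside[of GK] by blast
  then show False
    using arcs(2) by (metis Diff_eq_empty_iff arc_imp_simple_path ends(3,4) finite.emptyI
        finite_insert infinite_super nonempty_simple_path_endless)
qed

text \<open>By \<open>face_outside\<close> such a face lies outside all three cycles. Hence each
  open arc lies outside the cycle of the other two, and the three insides are pairwise disjoint,
  which cannot happen in the plane.\<close>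

lemma no_common_face:
  assumes F: "F \<noteq> {}" "topological_space_class.connected F" "F \<inter> (path_image g \<union> path_image h \<union> path_image k) = {}"
    and g: "closure F \<inter> (path_image g - {a, b}) \<noteq> {}"
    and h: "closure F \<inter> (path_image h - {a, b}) \<noteq> {}"
    and k: "closure F \<inter> (path_image k - {a, b}) \<noteq> {}"
  shows False
proof -
  interpret hkg: theta_curve h k g a b by (rule rotate)
  interpret kgh: theta_curve k g h a b by (rule hkg.rotate)
  have comm: "path_image h \<union> path_image g = GH" "path_image k \<union> path_image g = GK"
    "path_image k \<union> path_image h = HK" by auto
  have F': "F \<inter> (path_image h \<union> path_image k \<union> path_image g) = {}"
    "F \<inter> (path_image k \<union> path_image g \<union> path_image h) = {}" using F(3) by auto
  have "F \<inter> inside GH = {}" by (rule face_outside[OF F(2,3) g h k])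
  moreover have "F \<inter> inside HK = {}" by (rule hkg.face_outside[OF F(2) F'(1) h k g])
  moreover have "F \<inter> inside GK = {}" using kgh.face_outside[OF F(2) F'(2) k g h] by (simp only: comm)
  ultimately have out: "F \<subseteq> outside GH" "F \<subseteq> outside HK" "F \<subseteq> outside GK"
    using F(3) GH(7) HK(7) GK(7) by blast+
  have arcs_out: "path_image k - {a, b} \<subseteq> outside GH" "path_image g - {a, b} \<subseteq> outside HK"
    "path_image h - {a, b} \<subseteq> outside GK"
    using arc_outside[OF out(1) k] hkg.arc_outside[OF out(2) g] kgh.arc_outside[unfolded comm, OF out(3) h]
    by (simp_all only: comm)
  have dis: "inside GH \<inter> inside GK = {}" "inside GH \<inter> inside HK = {}" "inside GK \<inter> inside HK = {}"
    using insides_disjoint[OF arcs_out(1,3)] hkg.insides_disjoint[unfolded comm, OF arcs_out(2,1)]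
      kgh.insides_disjoint[unfolded comm, OF arcs_out(3,2)]
    by (simp_all only: Int_commute)
  \<comment> \<open>The closed regions \<open>?S\<close> and \<open>?T\<close> meet in the arc \<open>g\<close> only, so by Janiszewski their union does not
    separate the plane, although it contains \<open>HK\<close>.\<close>
  let ?S = "inside GH \<union> GH" and ?T = "inside GK \<union> GK"
  let ?U = "path_image g \<union> path_image h \<union> path_image k"
  have a_b: "a \<in> GH" "b \<in> GH" "a \<in> HK" "b \<in> HK" "a \<in> GK" "b \<in> GK" using disjoint by auto
  have k_sub: "path_image k \<subseteq> outside GH \<union> GH" using arcs_out(1) a_b by blast
  have g_sub: "path_image g \<subseteq> outside HK \<union> HK" using arcs_out(2) a_b by blast
  have h_sub: "path_image h \<subseteq> outside GK \<union> GK" using arcs_out(3) a_b by blast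
  have noU: "?U \<inter> inside GH = {}" "?U \<inter> inside HK = {}" "?U \<inter> inside GK = {}"
    using k_sub inside_no_overlap[of GH] inside_Int_outside[of GH] apply blast
    using g_sub inside_no_overlap[of HK] inside_Int_outside[of HK] apply blast
    using h_sub inside_no_overlap[of GK] inside_Int_outside[of GK] by blast
  have cl: "closure (inside GH) = ?S" "closure (inside GK) = ?T"
    by (metis GH(8) closure_Un_frontier) (metis GK(8) closure_Un_frontier)
  have comp: "compact ?S" "compact ?T"
    by (metis GH(6) cl(1) compact_closure) (metis GK(6) cl(2) compact_closure)
  have ST: "?S \<inter> ?T = path_image g"
  proof (intro equalityI subsetI)
    fix x assume "x \<in> ?S \<inter> ?T"
    then have "x \<in> GH" "x \<in> GK" using dis(1) noU by auto
    then show "x \<in> path_image g" using disjoint by auto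
  qed auto
  have compl: "- ?S = outside GH" "- ?T = outside GK"
    using GH(7) inside_Int_outside[of GH] outside_no_overlap[of GH] apply blast
    using GK(7) inside_Int_outside[of GK] outside_no_overlap[of GK] by blast
  have conn: "topological_space_class.connected (- (?S \<union> ?T))"
  proof (rule Janiszewski_connected)
    show "closed ?T" by (rule compact_imp_closed[OF comp(2)])
    show "topological_space_class.connected (?S \<inter> ?T)" unfolding ST using arcs(1) by (rule connected_arc_image)
  qed (simp_all only: comp compl GH(5) GK(5))
  \<comment> \<open>The complement of \<open>?S \<union> ?T\<close> is connected and avoids
    \<open>HK\<close>, yet it contains a point of \<open>inside HK\<close> and also the points of
    \<open>F\<close>, which lie outside \<open>HK\<close>.\<close>
  obtain x where x: "x \<in> inside HK" using HK(3) by auto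
  have x': "x \<in> - (?S \<union> ?T)"
    using x dis(2,3) noU(2) by auto
  have "- (?S \<union> ?T) \<subseteq> inside HK"
  proof (rule connected_subset_inside[OF HK(1) conn])
    show "- (?S \<union> ?T) \<inter> inside HK \<noteq> {}" using x x' by blast
  qed auto
  moreover obtain y where y: "y \<in> F" using F(1) by auto
  then have "y \<in> - (?S \<union> ?T)" using out(1,3) compl by blast
  moreover have "y \<notin> inside HK" using y out(2) inside_Int_outside[of HK] by blast
  ultimately show False by blast
qed

end

section \<open>Ears of theta-free graphs\<close>

text \<open>An interior vertex is demanded because an outerplanar graph may contain a theta one of
  whose paths is a single edge: a cycle with a chord. A walk inside \<open>A\<close> is enough and
  makes the notion monotone in \<open>A\<close>; \<open>link_path\<close> later extracts a
  path.\<close>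

definition link :: "('a \<times> 'a) set \<Rightarrow> 'a \<Rightarrow> 'a \<Rightarrow> 'a set \<Rightarrow> bool" where
  "link E u v A \<longleftrightarrow> (\<exists>a\<in>A. \<exists>b\<in>A. (u, a) \<in> E \<and> (a, b) \<in> (Restr E A)\<^sup>* \<and> (b, v) \<in> E)"

lemma link_mono: "link E u v A \<Longrightarrow> A \<subseteq> B \<Longrightarrow> link E u v B"
  unfolding link_def using rtrancl_mono[of "Restr E A" "Restr E B"] by blast

lemma link_sym: "sym E \<Longrightarrow> link E u v A \<Longrightarrow> link E v u A"
proof -
  assume "sym E"
  then have "sym ((Restr E A)\<^sup>*)" by (intro sym_rtrancl) (auto simp: sym_def)
  then show "link E u v A \<Longrightarrow> link E v u A"
    unfolding link_def using \<open>sym E\<close> by (meson symD)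
qed

lemma rtrancl_chain:
  assumes "i \<le> j" "\<And>l. i \<le> l \<Longrightarrow> l < j \<Longrightarrow> (x l, x (Suc l)) \<in> R"
  shows "(x i, x j) \<in> R\<^sup>*"
  using assms by (induction j rule: dec_induct) (auto intro: rtrancl_into_rtrancl)

lemma rtrancl_chain_down:
  assumes "i \<le> j" "\<And>l. i \<le> l \<Longrightarrow> l < j \<Longrightarrow> (x (Suc l), x l) \<in> R"
  shows "(x j, x i) \<in> R\<^sup>*"
  using assms by (induction j rule: dec_induct) (auto intro: converse_rtrancl_into_rtrancl)

text \<open>Take the least power of \<open>R\<close> that relates \<open>u\<close> to
  \<open>v\<close>: a repeated vertex or a forward chord would give a smaller one.\<close>

lemma shortest_path:
  assumes "(u, v) \<in> R\<^sup>*"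
  obtains n f where "f 0 = u" "f n = v" "\<And>i. i < n \<Longrightarrow> (f i, f (Suc i)) \<in> R"
    "inj_on f {..n}" "\<And>i j. i < j \<Longrightarrow> j \<le> n \<Longrightarrow> (f i, f j) \<in> R \<Longrightarrow> j = Suc i"
proof -
  define n where "n = (LEAST n. (u, v) \<in> R ^^ n)"
  have n: "(u, v) \<in> R ^^ n"
    unfolding n_def using assms rtrancl_imp_relpow by (metis LeastI)
  have least: "n \<le> k" if "(u, v) \<in> R ^^ k" for k
    unfolding n_def using that by (rule Least_le)
  obtain f where f: "f 0 = u" "f n = v" "\<And>i. i < n \<Longrightarrow> (f i, f (Suc i)) \<in> R"
    using n unfolding relpow_fun_conv by auto
  have pre: "(u, f i) \<in> R ^^ i" if "i \<le> n" for i
    unfolding relpow_fun_conv using f(1,3) that by (intro exI[of _ f]) simp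
  have post: "(f j, v) \<in> R ^^ (n - j)" if "j \<le> n" for j
    unfolding relpow_fun_conv using f(2,3) that by (intro exI[of _ "\<lambda>i. f (j + i)"]) simp
  have inj: "f i \<noteq> f j" if "i < j" "j \<le> n" for i j
  proof
    assume "f i = f j"
    then have "(u, v) \<in> R ^^ (i + (n - j))"
      unfolding relpow_add using pre[of i] post[of j] that by auto
    then show False using least that by fastforce
  qed
  have "j = Suc i" if "i < j" "j \<le> n" "(f i, f j) \<in> R" for i j
  proof -
    have "(u, v) \<in> R ^^ (Suc i + (n - j))"
      unfolding relpow_add using pre[of i] post[of j] that by auto
    then show ?thesis using least that by fastforce
  qed
  moreover have "inj_on f {..n}"
    using inj by (intro linorder_inj_onI) auto
  ultimately show thesis using that f by blast
qed

text \<open>This is all that the ears and the orientation need to know of the graph; embeddings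
  return only in \<open>outerplanar_no_theta\<close>. \<open>E\<close> stays fixed while the vertex
  set shrinks, so subgraphs are induced on sets \<open>V\<close> passed as arguments.\<close>

locale theta_free_graph =
  fixes E :: "('a \<times> 'a) set"
  assumes sym: "(x, y) \<in> E \<Longrightarrow> (y, x) \<in> E"
    and irrefl: "(x, x) \<notin> E"
    and triangle_free: "(x, y) \<in> E \<Longrightarrow> (y, z) \<in> E \<Longrightarrow> (z, x) \<notin> E"
    and no_theta: "u \<noteq> v \<Longrightarrow> link E u v A \<Longrightarrow> link E u v B \<Longrightarrow> link E u v C \<Longrightarrow>
      A \<inter> B = {} \<Longrightarrow> A \<inter> C = {} \<Longrightarrow> B \<inter> C = {} \<Longrightarrow> {u, v} \<inter> (A \<union> B \<union> C) = {} \<Longrightarrow> False"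
begin

lemma sym_E: "sym E"
  using sym by (auto intro: symI)

lemma sym_Restr_rtrancl: "(a, b) \<in> (Restr E A)\<^sup>* \<Longrightarrow> (b, a) \<in> (Restr E A)\<^sup>*"
  by (rule symD[OF sym_rtrancl]) (auto intro: symI sym)

definition nbrs :: "'a set \<Rightarrow> 'a set \<Rightarrow> 'a set" where
  "nbrs V W = {y \<in> V - W. \<exists>x\<in>W. (x, y) \<in> E}"

text \<open>For an edge \<open>ab\<close>: it is no bridge of the subgraph induced on
  \<open>V\<close>.\<close>

definition detour :: "'a set \<Rightarrow> 'a \<Rightarrow> 'a \<Rightarrow> bool" where
  "detour V a b \<longleftrightarrow> (a, b) \<in> (Restr E V - {(a, b), (b, a)})\<^sup>*"

lemma detour_mono: "detour S a b \<Longrightarrow> S \<subseteq> T \<Longrightarrow> detour T a b"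
  unfolding detour_def
  using rtrancl_mono[of "Restr E S - {(a, b), (b, a)}" "Restr E T - {(a, b), (b, a)}"] by blast

definition bridgeless_on :: "'a set \<Rightarrow> bool" where
  "bridgeless_on V \<longleftrightarrow> (\<forall>a\<in>V. \<forall>b\<in>V. (a, b) \<in> E \<longrightarrow> detour V a b)"

text \<open>A minimal flap turns out to be an isolated vertex or the interior of an ear.\<close>

definition flap :: "'a set \<Rightarrow> 'a set \<Rightarrow> bool" where
  "flap V W \<longleftrightarrow> W \<noteq> {} \<and> W \<subseteq> V \<and> ((\<exists>a. nbrs V W \<subseteq> {a}) \<or>
     (\<exists>a b. (a, b) \<in> E \<and> nbrs V W = {a, b} \<and> detour (V - W) a b))"

text \<open>The cycle has \<open>m + 1\<close> vertices and is closed by the edge from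
  \<open>x 0\<close> to \<open>x m\<close>, so \<open>3 \<le> m\<close> means length at least four,
  as triangle-freeness guarantees.\<close>

definition induced_cycle :: "(nat \<Rightarrow> 'a) \<Rightarrow> nat \<Rightarrow> bool" where
  "induced_cycle x m \<longleftrightarrow> 3 \<le> m \<and> inj_on x {..m} \<and>
     (\<forall>i j. i < j \<longrightarrow> j \<le> m \<longrightarrow> ((x i, x j) \<in> E \<longleftrightarrow> j = Suc i \<or> i = 0 \<and> j = m))"

text \<open>A shortest detour closes up with the edge \<open>uv\<close>. A chord would shorten the
  detour; length 1 would be the deleted edge, and length 2 would give a triangle.\<close>

lemma induced_cycle_exists:
  assumes "(u, v) \<in> E" "u \<in> S" "v \<in> S" "detour S u v"
  obtains x m where "induced_cycle x m" "x 0 = u" "x m = v" "x ` {..m} \<subseteq> S"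
proof -
  let ?R = "Restr E S - {(u, v), (v, u)}"
  obtain n f where f: "f 0 = u" "f n = v" "\<And>i. i < n \<Longrightarrow> (f i, f (Suc i)) \<in> ?R"
    "inj_on f {..n}" "\<And>i j. i < j \<Longrightarrow> j \<le> n \<Longrightarrow> (f i, f j) \<in> ?R \<Longrightarrow> j = Suc i"
    using assms(4) unfolding detour_def by (rule shortest_path) blast
  have inS: "f i \<in> S" if "i \<le> n" for i
    using that f(1) f(3)[of "i - 1"] assms(2) by (cases i) auto
  have "n \<noteq> 0" using f(1,2) assms(1) irrefl by metis
  moreover have "n \<noteq> 1" using f(1,2) f(3)[of 0] by auto
  moreover have "n \<noteq> 2"
    using f(1,2) f(3)[of 0] f(3)[of 1] assms(1) triangle_free[of u "f 1" v] sym by (auto simp: numeral_2_eq_2)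
  ultimately have "3 \<le> n" by linarith
  moreover have "(f i, f j) \<in> E \<longleftrightarrow> j = Suc i \<or> i = 0 \<and> j = n" if "i < j" "j \<le> n" for i j
  proof
    assume e: "(f i, f j) \<in> E"
    show "j = Suc i \<or> i = 0 \<and> j = n"
    proof (cases "(f i, f j) \<in> ?R")
      case True
      then show ?thesis using f(5) that by blast
    next
      case False
      then have "(f i = f 0 \<and> f j = f n) \<or> (f i = f n \<and> f j = f 0)"
        using e inS that f(1,2) by auto
      then have "(i = 0 \<and> j = n) \<or> (i = n \<and> j = 0)"
        using that f(4) by (auto simp: inj_on_def)
      then show ?thesis using that by auto
    qed
  next
    assume "j = Suc i \<or> i = 0 \<and> j = n"
    then show "(f i, f j) \<in> E" using f(1,2) f(3)[of i] that assms(1) by auto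
  qed
  ultimately have "induced_cycle f n" unfolding induced_cycle_def using f(4) by blast
  then show thesis using that f(1,2) inS by blast
qed

text \<open>Walks in \<open>S\<close> from \<open>y\<close> never leave the component
  \<open>K\<close>, so any two vertices of \<open>K\<close> are joined inside
  \<open>K\<close>.\<close>

lemma component_link:
  assumes K: "K = {z. (y, z) \<in> (Restr E S)\<^sup>*}" and "(a, ka) \<in> E" "ka \<in> K" "(kb, b) \<in> E" "kb \<in> K"
  shows "link E a b K"
proof -
  have "(y, z) \<in> (Restr E K)\<^sup>*" if "z \<in> K" for z
  proof -
    have "(y, z) \<in> (Restr E S)\<^sup>*" using that K by simp
    then show ?thesis
    proof induction
      case (step z z')
      have "z \<in> K" "z' \<in> K" unfolding K using step.hyps by (auto intro: rtrancl_into_rtrancl)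
      with step show ?case by (auto intro: rtrancl_into_rtrancl)
    qed simp
  qed
  then have "(ka, kb) \<in> (Restr E K)\<^sup>*" using assms(3,5) sym_Restr_rtrancl rtrancl_trans by metis
  then show ?thesis unfolding link_def using assms by blast
qed

text \<open>Nonadjacent vertices cut the cycle into two paths, each with an interior vertex. The
  second one uses the closing edge; its part below \<open>i\<close> or its part above
  \<open>j\<close> may be empty, which gives the three cases.\<close>

lemma cycle_links:
  assumes cyc: "induced_cycle x m" and ij: "i < j" "j \<le> m" and nadj: "(x i, x j) \<notin> E"
  shows "link E (x i) (x j) (x ` {i<..<j})" "link E (x i) (x j) (x ` ({..<i} \<union> {j<..m}))"
proof -
  have e: "(x l, x (Suc l)) \<in> E" if "l < m" for l
    using cyc that unfolding induced_cycle_def by (metis Suc_leI lessI)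
  have e0: "(x 0, x m) \<in> E"
    using cyc unfolding induced_cycle_def by (metis le_refl zero_less_iff_neq_zero not_numeral_le_zero)
  have nadj': "j \<noteq> Suc i" "\<not> (i = 0 \<and> j = m)" using nadj e e0 ij by auto
  show "link E (x i) (x j) (x ` {i<..<j})"
    unfolding link_def
  proof (intro bexI conjI)
    show "(x i, x (Suc i)) \<in> E" "(x (j - 1), x j) \<in> E" using e[of i] e[of "j - 1"] ij by auto
    show "(x (Suc i), x (j - 1)) \<in> (Restr E (x ` {i<..<j}))\<^sup>*"
      using ij nadj' e by (intro rtrancl_chain) auto
  qed (use ij nadj' in auto)
  let ?A = "x ` ({..<i} \<union> {j<..m})"
  have low: "(x (i - 1), x 0) \<in> (Restr E ?A)\<^sup>*" if "0 < i"
    using ij that sym[OF e] by (intro rtrancl_chain_down) auto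
  have high: "(x m, x (Suc j)) \<in> (Restr E ?A)\<^sup>*" if "j < m"
    using ij that sym[OF e] by (intro rtrancl_chain_down) auto
  have i1: "(x i, x (i - 1)) \<in> E" if "0 < i" using sym[OF e[of "i - 1"]] ij that by simp
  have j1: "(x (Suc j), x j) \<in> E" if "j < m" using sym[OF e[of j]] that by simp
  consider "i = 0" "j < m" | "0 < i" "j = m" | "0 < i" "j < m" using ij nadj' by linarith
  then show "link E (x i) (x j) ?A"
  proof cases
    case 1
    then show ?thesis unfolding link_def using high j1 e0
      by (intro bexI[of _ "x m"] bexI[of _ "x (Suc j)"]) auto
  next
    case 2
    then show ?thesis unfolding link_def using low i1 e0 ij
      by (intro bexI[of _ "x (i - 1)"] bexI[of _ "x 0"]) auto
  next
    case 3
    then have "(x 0, x m) \<in> Restr E ?A" using e0 ij by auto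
    then have "(x (i - 1), x (Suc j)) \<in> (Restr E ?A)\<^sup>*"
      using low high 3 by (meson rtrancl_into_rtrancl rtrancl_trans)
    then show ?thesis unfolding link_def using 3 i1 j1 ij
      by (intro bexI[of _ "x (i - 1)"] bexI[of _ "x (Suc j)"]) auto
  qed
qed

lemma cycle_detour:
  assumes cyc: "induced_cycle x m" and ij: "i < j" "j \<le> m" and adj: "(x i, x j) \<in> E"
    and S: "x ` {..m} \<subseteq> S"
  shows "detour S (x i) (x j)"
proof -
  let ?R = "Restr E S - {(x i, x j), (x j, x i)}"
  have inj: "x k = x l \<longleftrightarrow> k = l" if "k \<le> m" "l \<le> m" for k l
    using cyc that by (auto simp: induced_cycle_def inj_on_def)
  have e: "(x l, x (Suc l)) \<in> E" if "l < m" for l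
    using cyc that unfolding induced_cycle_def by (metis Suc_leI lessI)
  have m3: "3 \<le> m" using cyc by (simp add: induced_cycle_def)
  then have e0: "(x 0, x m) \<in> E"
    using cyc unfolding induced_cycle_def by (metis le_refl zero_less_iff_neq_zero not_numeral_le_zero)
  have R: "(x l, x (Suc l)) \<in> ?R" "(x (Suc l), x l) \<in> ?R" if "l < m" "l \<noteq> i \<or> Suc l \<noteq> j" for l
  proof -
    have "x l \<in> S" "x (Suc l) \<in> S" using S that by auto
    then show "(x l, x (Suc l)) \<in> ?R" "(x (Suc l), x l) \<in> ?R"
      using e[of l] sym that ij inj[of l i] inj[of "Suc l" j] inj[of l j] inj[of "Suc l" i] by auto
  qed
  have "j = Suc i \<or> i = 0 \<and> j = m"
    using cyc adj ij by (auto simp: induced_cycle_def)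
  then have "(x i, x j) \<in> ?R\<^sup>*"
  proof
    assume j: "j = Suc i"
    have "(x i, x 0) \<in> ?R\<^sup>*" using R(2) j ij by (intro rtrancl_chain_down) auto
    moreover have "(x 0, x m) \<in> ?R"
      using e0 S inj[of 0 i] inj[of m j] inj[of 0 j] inj[of m i] j ij m3 by auto
    moreover have "(x m, x j) \<in> ?R\<^sup>*" using R(2) j ij by (intro rtrancl_chain_down) auto
    ultimately show ?thesis by (meson rtrancl_into_rtrancl rtrancl_trans)
  next
    assume "i = 0 \<and> j = m"
    moreover have "(x 0, x m) \<in> ?R\<^sup>*"
    proof (rule rtrancl_chain)
      fix l assume "l < m"
      moreover have "l \<noteq> i \<or> Suc l \<noteq> j" using m3 \<open>i = 0 \<and> j = m\<close> by linarith
      ultimately show "(x l, x (Suc l)) \<in> ?R" by (rule R(1))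
    qed simp
    ultimately show ?thesis by simp
  qed
  then show ?thesis by (simp add: detour_def)
qed

text \<open>Two nonadjacent attachment vertices would give a theta, formed by the component and the
  two halves of the cycle. So the attachment vertices are pairwise adjacent, hence at most two by
  triangle-freeness; if there are two, the rest of the cycle is the detour that \<open>flap\<close>
  demands.\<close>

lemma component_flap:
  assumes cyc: "induced_cycle x m" "x ` {..m} \<subseteq> V" and K: "K = {z. (y, z) \<in> (Restr E S)\<^sup>*}" "K \<subseteq> V"
    and disj: "x ` {..m} \<inter> K = {}" and nbrs: "nbrs V K \<subseteq> x ` {..m}"
  shows "flap V K"
proof (cases "\<exists>a. nbrs V K \<subseteq> {a}")
  case True
  have "y \<in> K" using K by simp
  with True K(2) show ?thesis unfolding flap_def by blast
next
  case False
  have inj: "x k = x l \<longleftrightarrow> k = l" if "k \<le> m" "l \<le> m" for k l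
    using cyc(1) that by (auto simp: induced_cycle_def inj_on_def)
  have link: "link E a b K" if "a \<in> nbrs V K" "b \<in> nbrs V K" for a b
    using that component_link[OF K(1)] sym unfolding nbrs_def by blast
  have adj: "(x i, x j) \<in> E" if "x i \<in> nbrs V K" "x j \<in> nbrs V K" "i < j" "j \<le> m" for i j
  proof (rule ccontr)
    assume "(x i, x j) \<notin> E"
    note links = cycle_links[OF cyc(1) that(3,4) this]
    have sub: "x ` {i<..<j} \<subseteq> x ` {..m}" "x ` ({..<i} \<union> {j<..m}) \<subseteq> x ` {..m}"
      "x i \<in> x ` {..m}" "x j \<in> x ` {..m}"
      using that by auto
    show False
    proof (rule no_theta[OF _ link[OF that(1,2)] links])
      show "x i \<noteq> x j" using inj that by auto
      show "K \<inter> x ` {i<..<j} = {}" "K \<inter> x ` ({..<i} \<union> {j<..m}) = {}"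
        using sub disj by blast+
      show "x ` {i<..<j} \<inter> x ` ({..<i} \<union> {j<..m}) = {}" using inj that by fastforce
      have "x i \<notin> K" "x j \<notin> K" using sub disj by blast+
      moreover have "x i \<notin> x ` {i<..<j}" "x j \<notin> x ` {i<..<j}"
        "x i \<notin> x ` ({..<i} \<union> {j<..m})" "x j \<notin> x ` ({..<i} \<union> {j<..m})"
        using inj that by fastforce+
      ultimately show "{x i, x j} \<inter> (K \<union> x ` {i<..<j} \<union> x ` ({..<i} \<union> {j<..m})) = {}" by blast
    qed
  qed
  have adj': "(a, b) \<in> E" if ab: "a \<in> nbrs V K" "b \<in> nbrs V K" "a \<noteq> b" for a b
  proof -
    obtain i j where "a = x i" "b = x j" "i \<le> m" "j \<le> m" using ab nbrs by blast
    then show ?thesis using adj[of i j] adj[of j i] ab sym by (metis linorder_neqE_nat)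
  qed
  obtain a b where ab: "a \<in> nbrs V K" "b \<in> nbrs V K" "a \<noteq> b"
    using False by blast
  then have nb: "nbrs V K = {a, b}" using adj' triangle_free sym by blast
  obtain i j where ij: "i < j" "j \<le> m" "{a, b} = {x i, x j}"
  proof -
    obtain i j where "a = x i" "b = x j" "i \<le> m" "j \<le> m" using ab nbrs by blast
    then show thesis using that[of i j] that[of j i] ab(3) by (metis insert_commute linorder_neqE_nat)
  qed
  then have "(x i, x j) \<in> E" using adj nb by auto
  moreover have "x ` {..m} \<subseteq> V - K" using cyc disj by auto
  ultimately have "detour (V - K) (x i) (x j)" using cycle_detour cyc(1) ij by blast
  moreover have "y \<in> K" using K by simp
  ultimately show ?thesis
    unfolding flap_def using nb ij \<open>(x i, x j) \<in> E\<close> K(2) by blast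
qed

text \<open>Consider a flap \<open>W\<close> of least size. With one attachment \<open>a\<close>,
  bridgelessness provides a cycle through \<open>a\<close> inside \<open>insert a W\<close>; with
  two, a path through \<open>W\<close> closes up with the edge between them. By minimality
  \<open>W\<close> has no vertex off an induced cycle of this kind, so it is the interior of an ear.
  Without attachments \<open>W\<close> is a single vertex \<open>v\<close>, since a component of
  \<open>W - {v}\<close> would be a smaller flap attached at \<open>v\<close>.\<close>

lemma ear_exists:
  assumes V: "finite V" "V \<noteq> {}" "bridgeless_on V"
  obtains (isolated) v where "v \<in> V" "\<And>y. y \<in> V \<Longrightarrow> (v, y) \<notin> E"
  | (ear) x k W where "2 \<le> k" "inj_on x {1..k}" "W = x ` {1..k}" "W \<subseteq> V" "x 0 \<in> V - W" "x (Suc k) \<in> V - W"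
    "\<And>i y. 1 \<le> i \<Longrightarrow> i \<le> k \<Longrightarrow> y \<in> V \<Longrightarrow> (x i, y) \<in> E \<longleftrightarrow> y = x (i - 1) \<or> y = x (Suc i)"
    "x 0 = x (Suc k) \<and> 3 \<le> k \<or> (x 0, x (Suc k)) \<in> E \<and> detour (V - W) (x 0) (x (Suc k))"
proof -
  have "flap V V" unfolding flap_def nbrs_def using V(2) by auto
  then obtain W where W: "flap V W" and minimal: "\<And>W'. flap V W' \<Longrightarrow> card W \<le> card W'"
    using exists_least_iff[of "\<lambda>n. \<exists>W. flap V W \<and> card W = n"] by (metis linorder_not_le)
  have WV: "W \<subseteq> V" "W \<noteq> {}" using W by (auto simp: flap_def)
  have no_smaller: "\<not> flap V K" if "K \<subset> W" for K
    using minimal[of K] psubset_card_mono[OF finite_subset[OF WV(1) V(1)] that] by linarith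
  have comp: "K \<subseteq> S" "nbrs V K \<inter> S = {}" "y \<in> K"
    if "K = {z. (y, z) \<in> (Restr E S)\<^sup>*}" "y \<in> S" for y S K
  proof -
    show "y \<in> K" using that by simp
    show "K \<subseteq> S"
    proof
      fix z assume "z \<in> K"
      then have "(y, z) \<in> (Restr E S)\<^sup>*" using that by simp
      then show "z \<in> S" by induction (use that in auto)
    qed
    then show "nbrs V K \<inter> S = {}"
      unfolding nbrs_def using that by (auto intro: rtrancl_into_rtrancl)
  qed
  \<comment> \<open>A component of \<open>W\<close> off the induced cycle would be a smaller flap.\<close>
  have core: ?thesis
    if cyc: "induced_cycle x m" "x ` {..m} \<subseteq> V" "nbrs V W \<subseteq> x ` {..m}"
      and Wx: "W \<inter> x ` {..m} = x ` {1..k}" and x0: "x 0 \<notin> W"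
      \<comment> \<open>If \<open>k = m\<close>, only \<open>x 0\<close> lies off \<open>W\<close>,
        and the ear has equal ends. If \<open>Suc k = m\<close>, the vertex \<open>x m\<close> is
        its other end.\<close>
      and k: "k = m \<and> nbrs V W \<subseteq> {x 0} \<or> Suc k = m \<and> x m \<notin> W \<and> detour (V - W) (x 0) (x m)"
    for x m k
  proof -
    have m3: "3 \<le> m" using cyc(1) by (simp add: induced_cycle_def)
    have inj: "x i = x l \<longleftrightarrow> i = l" if "i \<le> m" "l \<le> m" for i l
      using cyc(1) that by (auto simp: induced_cycle_def inj_on_def)
    have adj: "(x i, x j) \<in> E \<longleftrightarrow> j = Suc i \<or> i = 0 \<and> j = m" if "i < j" "j \<le> m" for i j
      using cyc(1) that by (auto simp: induced_cycle_def)
    have W_eq: "W = x ` {1..k}"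
    proof (rule ccontr)
      assume "W \<noteq> x ` {1..k}"
      then obtain y where y: "y \<in> W - x ` {..m}" using Wx by blast
      define S where "S = W - x ` {..m}"
      define K where "K = {z. (y, z) \<in> (Restr E S)\<^sup>*}"
      note K = comp[OF K_def y[folded S_def]]
      have "nbrs V K \<subseteq> x ` {..m}"
      proof
        fix z assume z: "z \<in> nbrs V K"
        show "z \<in> x ` {..m}"
        proof (cases "z \<in> W")
          case True
          then show ?thesis using z K(2) by (auto simp: S_def)
        next
          case False
          then have "z \<in> nbrs V W" using z K(1) by (auto simp: nbrs_def S_def)
          then show ?thesis using cyc(3) by blast
        qed
      qed
      moreover have "K \<subseteq> V" "x ` {..m} \<inter> K = {}" using K(1) WV by (auto simp: S_def)
      ultimately have "flap V K" using component_flap[OF cyc(1,2) K_def] by blast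
      moreover have "x 1 \<in> x ` {1..k}" using k m3 by (intro imageI) auto
      then have "x 1 \<in> W" using Wx by blast
      then have "K \<subset> W" using K(1) m3 by (auto simp: S_def)
      ultimately show False using no_smaller by blast
    qed
    \<comment> \<open>An ear is indexed from \<open>0\<close> to \<open>Suc k\<close>; in the case
      \<open>k = m\<close> the index \<open>Suc m\<close> has to return to
      \<open>x 0\<close>.\<close>
    define x' where "x' = (\<lambda>i. if i = Suc m then x 0 else x i)"
    have km: "k \<le> m" "2 \<le> k" using k m3 by auto
    have x'_eq: "x' i = x i" if "i \<le> m" for i using that by (simp add: x'_def)
    have nb: "(x i, y) \<in> E \<longleftrightarrow> y = x' (i - 1) \<or> y = x' (Suc i)" if i: "1 \<le> i" "i \<le> k" and y: "y \<in> V" for i y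
    proof -
      have iW: "x i \<in> W" using W_eq i by auto
      have "y \<in> x ` {..m}" if "(x i, y) \<in> E"
      proof (cases "y \<in> W")
        case True
        then show ?thesis using Wx W_eq by blast
      next
        case False
        then have "y \<in> nbrs V W" using that iW y by (auto simp: nbrs_def)
        then show ?thesis using cyc(3) by blast
      qed
      then have "(x i, y) \<in> E \<longleftrightarrow> (\<exists>j\<le>m. y = x j \<and> (x i, x j) \<in> E)" by auto
      also have "\<dots> \<longleftrightarrow> y = x' (i - 1) \<or> y = x' (Suc i)"
      proof -
        have 1: "(x i, x j) \<in> E \<longleftrightarrow> j = i - 1 \<or> j = Suc i \<or> i = m \<and> j = 0" if "j \<le> m" for j
        proof (cases i j rule: linorder_cases)
          case less
          then show ?thesis using adj[of i j] that i by auto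
        next
          case equal
          then show ?thesis using irrefl i km m3 by auto
        next
          case greater
          have "(x i, x j) \<in> E \<longleftrightarrow> (x j, x i) \<in> E" using sym by blast
          also have "\<dots> \<longleftrightarrow> i = Suc j \<or> j = 0 \<and> i = m" using greater i km by (intro adj) auto
          finally show ?thesis using greater by auto
        qed
        show ?thesis
        proof (cases "i = m")
          case True
          then have "x' (Suc i) = x 0" "x' (i - 1) = x (i - 1)" by (auto simp: x'_def)
          moreover have "(\<exists>j\<le>m. y = x j \<and> (x i, x j) \<in> E) \<longleftrightarrow> (\<exists>j\<le>m. y = x j \<and> (j = i - 1 \<or> j = 0))"
            using 1 True by auto
          ultimately show ?thesis using True by (metis diff_le_self le0)
        next
          case False
          then have "x' (Suc i) = x (Suc i)" "x' (i - 1) = x (i - 1)" "Suc i \<le> m" using i km by (auto simp: x'_def)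
          moreover have "(\<exists>j\<le>m. y = x j \<and> (x i, x j) \<in> E) \<longleftrightarrow> (\<exists>j\<le>m. y = x j \<and> (j = i - 1 \<or> j = Suc i))"
            using 1 False by auto
          moreover have "i - 1 \<le> m" using i km by linarith
          ultimately show ?thesis by metis
        qed
      qed
      finally show ?thesis .
    qed
    show thesis
    proof (rule ear[of k x' W])
      show "2 \<le> k" by (rule km)
      show "inj_on x' {1..k}" using inj km by (auto simp: inj_on_def x'_def)
      have "x' ` {1..k} = x ` {1..k}" using km by (intro image_cong) (auto simp: x'_def)
      then show "W = x' ` {1..k}" using W_eq by simp
      show "W \<subseteq> V" by (rule WV)
      show x'0: "x' 0 \<in> V - W" using x0 cyc(2) by (auto simp: x'_def)
      show "x' (Suc k) \<in> V - W"
        using k x'0 cyc(2) m3 by (auto simp: x'_def)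
      show "(x' i, y) \<in> E \<longleftrightarrow> y = x' (i - 1) \<or> y = x' (Suc i)" if "1 \<le> i" "i \<le> k" "y \<in> V" for i y
        using nb[OF that] x'_eq[of i] that km by simp
      show "x' 0 = x' (Suc k) \<and> 3 \<le> k \<or> (x' 0, x' (Suc k)) \<in> E \<and> detour (V - W) (x' 0) (x' (Suc k))"
        using k m3 adj[of 0 m] by (auto simp: x'_def)
    qed
  qed
  \<comment> \<open>A component of \<open>W\<close> has no attachments but those of
    \<open>W\<close>, hence is itself a flap; so minimality makes \<open>W\<close>
    connected.\<close>
  have conn: "(y, z) \<in> (Restr E W)\<^sup>*" if "y \<in> W" "z \<in> W" for y z
  proof -
    define K where "K = {z. (y, z) \<in> (Restr E W)\<^sup>*}"
    note K = comp[OF K_def that(1)]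
    have nb: "nbrs V K \<subseteq> nbrs V W" using K(1,2) by (auto simp: nbrs_def)
    have "flap V K"
      using W unfolding flap_def
    proof (elim conjE disjE exE)
      fix a assume "nbrs V W \<subseteq> {a}"
      then show "K \<noteq> {} \<and> K \<subseteq> V \<and> ((\<exists>a. nbrs V K \<subseteq> {a}) \<or>
        (\<exists>a b. (a, b) \<in> E \<and> nbrs V K = {a, b} \<and> detour (V - K) a b))"
        using nb K WV by blast
    next
      fix a b assume *: "(a, b) \<in> E" "nbrs V W = {a, b}" "detour (V - W) a b"
      have "detour (V - K) a b"
        using detour_mono[OF *(3)] K(1) by blast
      moreover have "nbrs V K \<subseteq> {a, b}" using nb *(2) by blast
      then have "nbrs V K \<subseteq> {a} \<or> nbrs V K \<subseteq> {b} \<or> nbrs V K = {a, b}"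
        by (cases "a \<in> nbrs V K"; cases "b \<in> nbrs V K") auto
      ultimately show "K \<noteq> {} \<and> K \<subseteq> V \<and> ((\<exists>a. nbrs V K \<subseteq> {a}) \<or>
        (\<exists>a b. (a, b) \<in> E \<and> nbrs V K = {a, b} \<and> detour (V - K) a b))"
        using K WV *(1) by blast
    qed
    then have "K = W" using no_smaller K(1) by blast
    then show ?thesis using that by (auto simp: K_def)
  qed
  consider (none) "nbrs V W = {}" | (one) a where "nbrs V W = {a}"
    | (two) a b where "(a, b) \<in> E" "nbrs V W = {a, b}" "detour (V - W) a b"
    using W unfolding flap_def by blast
  then show thesis
  proof cases
    case none
    obtain v where v: "v \<in> W" using WV by auto
    have "W = {v}"
    proof (rule ccontr)
      assume "W \<noteq> {v}"
      then obtain y where y: "y \<in> W - {v}" using v by blast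
      define K where "K = {z. (y, z) \<in> (Restr E (W - {v}))\<^sup>*}"
      note K = comp[OF K_def y]
      have "nbrs V K \<subseteq> {v}"
        using K(1,2) none by (auto simp: nbrs_def)
      then have "flap V K" using K WV by (auto simp: flap_def)
      then show False using no_smaller K(1) v by blast
    qed
    then show thesis using isolated[of v] v WV none irrefl by (auto simp: nbrs_def)
  next
    case (one a)
    then obtain w where w: "w \<in> W" "(w, a) \<in> E" and a: "a \<in> V - W" by (auto simp: nbrs_def)
    have "detour V w a" using V(3) w a WV by (auto simp: bridgeless_on_def)
    define R where "R = Restr E (insert a W) - {(w, a), (a, w)}"
    \<comment> \<open>The detour may run outside \<open>insert a W\<close>, but it can leave
      \<open>W\<close> only through \<open>a\<close>. So whenever it is off \<open>W\<close>, it has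
      already reached \<open>a\<close> within \<open>R\<close>.\<close>
    have "(y \<in> W \<longrightarrow> (w, y) \<in> R\<^sup>*) \<and> (y \<notin> W \<longrightarrow> (w, a) \<in> R\<^sup>*)" if "(w, y) \<in> (Restr E V - {(w, a), (a, w)})\<^sup>*" for y
      using that
    proof induction
      case base
      then show ?case using w by auto
    next
      case (step y z)
      show ?case
      proof (cases "y \<in> W")
        case True
        then have "z \<in> W \<or> z = a" using step.hyps one by (auto simp: nbrs_def)
        then have "(y, z) \<in> R" using step.hyps True by (auto simp: R_def)
        then show ?thesis using step.IH True \<open>z \<in> W \<or> z = a\<close> by (auto intro: rtrancl_into_rtrancl)
      next
        case False
        then have wa: "(w, a) \<in> R\<^sup>*" using step.IH by simp
        moreover have "(w, z) \<in> R\<^sup>*" if "z \<in> W"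
        proof -
          have "y = a" using that False step.hyps one sym by (auto simp: nbrs_def)
          then have "(a, z) \<in> R" using that step.hyps by (auto simp: R_def)
          then show ?thesis using wa by (rule rtrancl_into_rtrancl[rotated])
        qed
        ultimately show ?thesis by simp
      qed
    qed
    then have "(w, a) \<in> R\<^sup>*" using \<open>detour V w a\<close> a unfolding detour_def by blast
    moreover have "sym R" by (auto simp: R_def sym_def sym)
    ultimately have "(a, w) \<in> R\<^sup>*" using sym_rtrancl by (metis symD)
    then have "detour (insert a W) a w" unfolding detour_def R_def by (simp add: insert_commute)
    then obtain x m where x: "induced_cycle x m" "x 0 = a" "x m = w" "x ` {..m} \<subseteq> insert a W"
      using induced_cycle_exists[of a w "insert a W"] sym w by blast
    have inj: "x i \<noteq> x 0" if "1 \<le> i" "i \<le> m" for i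
      using x(1) that by (auto simp: induced_cycle_def inj_on_def)
    show thesis
    proof (rule core[of x m m])
      show "W \<inter> x ` {..m} = x ` {1..m}"
      proof (intro equalityI subsetI)
        fix y assume "y \<in> W \<inter> x ` {..m}"
        then obtain i where i: "i \<le> m" "y = x i" "y \<in> W" by auto
        then have "i \<noteq> 0" using x(2) a by (intro notI) auto
        then show "y \<in> x ` {1..m}" using i by auto
      next
        fix y assume "y \<in> x ` {1..m}"
        then obtain i where i: "1 \<le> i" "i \<le> m" "y = x i" by auto
        then have "y \<in> insert a W" using x(4) by auto
        then show "y \<in> W \<inter> x ` {..m}" using inj[of i] i x(2) by auto
      qed
    qed (use x a one WV in auto)
  next
    case (two a b)
    then have ab: "a \<in> V - W" "b \<in> V - W" "a \<noteq> b" using irrefl by (auto simp: nbrs_def)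
    have "a \<in> nbrs V W" "b \<in> nbrs V W" using two(2) by auto
    then obtain wa wb where w: "wa \<in> W" "wb \<in> W" "(wa, a) \<in> E" "(wb, b) \<in> E"
      unfolding nbrs_def by blast
    let ?S = "insert a (insert b W)"
    let ?R = "Restr E ?S - {(a, b), (b, a)}"
    have "Restr E W \<subseteq> ?R" using ab by auto
    then have "(wa, wb) \<in> ?R\<^sup>*"
      using conn[OF w(1,2)] rtrancl_mono by blast
    moreover have "(a, wa) \<in> ?R" "(wb, b) \<in> ?R" using w ab sym by auto
    ultimately have "detour ?S a b"
      unfolding detour_def by (meson converse_rtrancl_into_rtrancl rtrancl_into_rtrancl)
    then obtain x m where x: "induced_cycle x m" "x 0 = a" "x m = b" "x ` {..m} \<subseteq> ?S"
      using induced_cycle_exists[of a b ?S] two(1) by blast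
    have inj: "x i \<noteq> x 0" if "1 \<le> i" "i \<le> m" for i
      using x(1) that by (auto simp: induced_cycle_def inj_on_def)
    have inj': "x i \<noteq> x m" if "i < m" for i
      using x(1) that by (auto simp: induced_cycle_def inj_on_def)
    have m3: "3 \<le> m" using x(1) by (simp add: induced_cycle_def)
    show thesis
    proof (rule core[of x m "m - 1"])
      show "W \<inter> x ` {..m} = x ` {1..m - 1}"
      proof (intro equalityI subsetI)
        fix y assume "y \<in> W \<inter> x ` {..m}"
        then obtain i where i: "i \<le> m" "y = x i" "y \<in> W" by auto
        then have "i \<noteq> 0" "i \<noteq> m" using x(2,3) ab by (intro notI; auto)+
        then have "i \<in> {1..m - 1}" using i by auto
        then show "y \<in> x ` {1..m - 1}" using i by blast
      next
        fix y assume "y \<in> x ` {1..m - 1}"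
        then obtain i where i: "1 \<le> i" "i < m" "y = x i" using m3 by auto
        then have "y \<in> x ` {..m}" by auto
        then have "y \<in> ?S" using x(4) by blast
        then show "y \<in> W \<inter> x ` {..m}" using inj[of i] inj'[of i] i x(2,3) by auto
      qed
      show "nbrs V W \<subseteq> x ` {..m}" using two(2) x(2,3) by auto
      show "x ` {..m} \<subseteq> V" using x(4) ab WV by auto
    qed (use x ab two(3) m3 in auto)
  qed
qed

end

section \<open>Labelling an ear\<close>

text \<open>
  An entry \<open>(a, b, p, q)\<close> says that an ear whose ends have the final in-degrees \<open>a\<close> and \<open>b\<close> can send
  \<open>p\<close> and \<open>q\<close> arcs into them. The table was found by computer search, as a small subset
  of the largest table that reproduces itself.
\<close>

definition promise_table :: "(nat \<times> nat \<times> nat \<times> nat) list" where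
  "promise_table = [(0,1,0,0), (0,3,0,1), (0,4,0,0), (0,4,0,1), (1,2,0,1), (1,3,0,0), (1,3,0,1), (1,4,0,0),
     (2,3,1,0), (2,3,1,1), (3,4,0,1), (3,4,1,0),
     (1,0,0,0), (3,0,1,0), (4,0,0,0), (4,0,1,0), (2,1,1,0), (3,1,0,0), (3,1,1,0), (4,1,0,0),
     (3,2,0,1), (3,2,1,1), (4,3,1,0), (4,3,0,1)]"

text \<open>
  An entry \<open>(c, a)\<close> says that an ear attached at a single vertex of final in-degree \<open>a\<close> can send \<open>c\<close> arcs into it.
\<close>

definition gain_table :: "(nat \<times> nat) list" where
  "gain_table = [(0,0), (0,1), (0,3), (0,4), (1,3), (2,4)]"

text \<open>
  The triples \<open>(b, x, y)\<close> in \<open>moves m a\<close> describe the admissible edges, marked if \<open>m\<close> holds, from a vertex of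
  in-degree \<open>a\<close> to one of in-degree \<open>b\<close>: together with the ear promised on it, the edge
  contributes \<open>x\<close> to \<open>a\<close> and \<open>y\<close> to \<open>b\<close>.
\<close>

definition moves :: "bool \<Rightarrow> nat \<Rightarrow> (nat \<times> nat \<times> nat) list" where
  "moves m a = (if m then concat (map (\<lambda>(a', b, p, q). if a' = a then [(b, Suc p, q), (b, p, Suc q)] else []) promise_table)
     else concat (map (\<lambda>b. if b = a then [] else [(b, 1, 0), (b, 0, 1)]) [0..<5]))"

text \<open>\<open>c\<close> is the share of the in-degree \<open>D\<close> reserved for the ears
  promised at the vertex. In particular a marked vertex never gets in-degree 2.\<close>

definition vert_ok :: "bool \<Rightarrow> nat \<Rightarrow> nat \<Rightarrow> bool" where
  "vert_ok m c D \<longleftrightarrow> (if m then List.member gain_table (c, D) else c = 0)"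

text \<open>
  Traversing an ear, a state \<open>(D, l)\<close> records the in-degree of the current vertex and the part of it that
  has been contributed by the preceding edge.
\<close>

definition next_states :: "bool \<Rightarrow> bool \<Rightarrow> (nat \<times> nat) list \<Rightarrow> (nat \<times> nat) list" where
  "next_states v e S = remdups (concat (map (\<lambda>(D, l). concat (map (\<lambda>(b, x, y).
     if l + x \<le> D \<and> vert_ok v (D - (l + x)) D then [(b, y)] else []) (moves e D))) S))"

definition contained :: "'b list \<Rightarrow> 'b list \<Rightarrow> bool" where
  "contained S T \<longleftrightarrow> list_all (List.member T) S"

text \<open>The marks along an ear are imposed from outside, so a final state counts only if it lies
  in every set of the family. For this the inclusion-minimal sets suffice, which keeps the families
  small.\<close>

definition minimals :: "'b list list \<Rightarrow> 'b list list" where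
  "minimals F = fold (\<lambda>S G. if list_ex (\<lambda>T. contained T S) G then G else S # filter (\<lambda>T. \<not> contained S T) G) F []"

text \<open>
  A family contains, up to inclusion, the sets of reachable states for all possible marks.
  From the fourth vertex on it is \<open>full_family\<close>, irrespective of the start.
\<close>

definition next_family :: "(nat \<times> nat) list list \<Rightarrow> (nat \<times> nat) list list" where
  "next_family F = minimals (concat (map (\<lambda>S. [next_states False False S, next_states False True S, next_states True False S, next_states True True S]) F))"

definition first_states :: "nat \<Rightarrow> nat \<Rightarrow> bool \<Rightarrow> (nat \<times> nat) list" where
  "first_states a p e = concat (map (\<lambda>(b, x, y). if x = p then [(b, y)] else []) (moves e a))"

definition refines :: "(nat \<times> nat) list list \<Rightarrow> (nat \<times> nat) list list \<Rightarrow> bool" where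
  "refines F G \<longleftrightarrow> list_all (\<lambda>S. list_ex (\<lambda>T. contained T S) G) F"

text \<open>The first set consists of all states to which \<open>moves\<close> leads along an
  unmarked edge, from any in-degree up to 4; the second is the same for a marked edge. So by then
  only the last edge matters and the start is forgotten.\<close>

definition full_family :: "(nat \<times> nat) list list" where
  "full_family = [[(0,0), (0,1), (1,0), (1,1), (2,0), (2,1), (3,0), (3,1), (4,0), (4,1)],
     [(0,0), (0,1), (1,0), (1,1), (2,1), (2,2), (3,0), (3,1), (3,2), (4,0), (4,1), (4,2)]]"

definition ends_in :: "(nat \<times> nat) list \<Rightarrow> (nat \<times> nat) list list \<Rightarrow> bool" where
  "ends_in ts F \<longleftrightarrow> list_all (contained ts) F"

definition check_full :: "(nat \<times> nat) list list \<Rightarrow> bool" where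
  "check_full F \<longleftrightarrow> refines F full_family"

definition check3 :: "(nat \<times> nat) list \<Rightarrow> (nat \<times> nat) list \<Rightarrow> (nat \<times> nat) list list \<Rightarrow> bool" where
  "check3 ts cs F \<longleftrightarrow> ends_in ts F \<and> ends_in cs F \<and> check_full (next_family F)"

definition check2 :: "(nat \<times> nat) list \<Rightarrow> (nat \<times> nat) list \<Rightarrow> (nat \<times> nat) list list \<Rightarrow> bool" where
  "check2 ts cs F \<longleftrightarrow> ends_in ts F \<and> check3 ts cs (next_family F)"

text \<open>The first list holds the final states required of ears with distinct ends, which have
  two or more interior vertices. The second is for equal ends, where triangle-freeness forces at
  least three. As gains are at most 2, the conditions on \<open>c\<close> say
  \<open>p = c div 2\<close>: the gain is divided as evenly as possible between the two end
  edges.\<close>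

definition check :: "nat \<Rightarrow> nat \<Rightarrow> bool" where
  "check a p \<longleftrightarrow> check2 (concat (map (\<lambda>(a', b, p', q). if a' = a \<and> p' = p then [(b, q)] else []) promise_table))
     (concat (map (\<lambda>(c, D). if D = a \<and> p \<le> c \<and> c \<le> p + 1 \<and> p * 2 \<le> c then [(D, c - p)] else []) gain_table))
     (next_family (next_family [first_states a p False, first_states a p True]))"

section \<open>Evaluation of the tables\<close>

lemma check_0_0: "check 0 0" by code_simp
lemma check_1_0: "check 1 0" by code_simp
lemma check_1_1: "check 1 1" by code_simp
lemma check_2_1: "check 2 1" by code_simp
lemma check_3_0: "check 3 0" by code_simp
lemma check_3_1: "check 3 1" by code_simp
lemma check_4_0: "check 4 0" by code_simp
lemma check_4_1: "check 4 1" by code_simp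

text \<open>This settles all lengths at once: one more vertex, however marked, leads to sets that
  again contain a set of \<open>full_family\<close>.\<close>

lemma check_full_full: "check_full (next_family full_family)" by code_simp

text \<open>For ears with at least four interior vertices. In the second list the value
  \<open>c\<close> or 1 is \<open>c - c div 2\<close>, the share of the last edge.\<close>

lemma check_full_ends:
  "ends_in (concat (map (\<lambda>(a, b, p, q). [(b, q)]) promise_table)) full_family"
  "ends_in (concat (map (\<lambda>(c, D). if c < 2 then [(D, c)] else [(D, 1)]) gain_table)) full_family"
  by code_simp+

text \<open>The states for one given pattern of marks. Edge \<open>j\<close> runs from vertex
  \<open>j\<close> to vertex \<open>Suc j\<close>; after \<open>j\<close> interior vertices the
  state holds the in-degree of vertex \<open>Suc j\<close> and the contribution of edge
  \<open>j\<close> to it.\<close>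

inductive reach :: "(nat \<Rightarrow> bool) \<Rightarrow> (nat \<Rightarrow> bool) \<Rightarrow> nat \<Rightarrow> nat \<Rightarrow> nat \<Rightarrow> nat \<times> nat \<Rightarrow> bool"
  for mv me a p where
  start: "(b, p, y) \<in> set (moves (me 0) a) \<Longrightarrow> reach mv me a p 0 (b, y)"
| step: "reach mv me a p j (D, l) \<Longrightarrow> (b, x, y) \<in> set (moves (me (Suc j)) D) \<Longrightarrow> l + x \<le> D \<Longrightarrow>
    vert_ok (mv (Suc j)) (D - (l + x)) D \<Longrightarrow> reach mv me a p (Suc j) (b, y)"

text \<open>\<open>d i\<close> is the in-degree of vertex \<open>i\<close>, while \<open>f i\<close>
  and \<open>g i\<close> are the contributions of edge \<open>i\<close> to vertices \<open>i\<close>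
  and \<open>Suc i\<close>. What is left over at an interior vertex is the share of the ears
  promised there.\<close>

lemma reach_labels:
  assumes "reach mv me a p k s"
  shows "\<exists>d f g. d 0 = a \<and> f 0 = p \<and> d (Suc k) = fst s \<and> g k = snd s \<and>
    (\<forall>i\<le>k. (d (Suc i), f i, g i) \<in> set (moves (me i) (d i))) \<and>
    (\<forall>i<k. g i + f (Suc i) \<le> d (Suc i) \<and>
       vert_ok (mv (Suc i)) (d (Suc i) - (g i + f (Suc i))) (d (Suc i)))"
  using assms
proof (induction rule: reach.induct)
  case (start b y)
  show ?case
    by (rule exI[of _ "\<lambda>i. if i = 0 then a else b"], rule exI[of _ "\<lambda>_. p"], rule exI[of _ "\<lambda>_. y"])
      (use start in auto)
next
  case (step j D l b x y)
  then obtain d f g where *: "d 0 = a" "f 0 = p" "d (Suc j) = D" "g j = l"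
    "\<forall>i\<le>j. (d (Suc i), f i, g i) \<in> set (moves (me i) (d i))"
    "\<forall>i<j. g i + f (Suc i) \<le> d (Suc i) \<and>
       vert_ok (mv (Suc i)) (d (Suc i) - (g i + f (Suc i))) (d (Suc i))" by auto
  show ?case
    by (rule exI[of _ "d(Suc (Suc j) := b)"], rule exI[of _ "f(Suc j := x)"],
        rule exI[of _ "g(Suc j := y)"])
      (use * step in \<open>auto simp: le_Suc_eq less_Suc_eq\<close>)
qed

text \<open>The link between families and actual marks: which set is the right one depends on the
  marks and is left open, so a state is known to be reachable once it lies in all sets.\<close>

definition covers :: "(nat \<times> nat) list list \<Rightarrow> (nat \<times> nat \<Rightarrow> bool) \<Rightarrow> bool" where
  "covers F P \<longleftrightarrow> (\<exists>S\<in>set F. \<forall>s\<in>set S. P s)"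

lemma contained_iff: "contained S T \<longleftrightarrow> set S \<subseteq> set T"
  by (auto simp: contained_def list_all_iff)

lemma covers_refines: "refines F G \<Longrightarrow> covers F P \<Longrightarrow> covers G P"
  unfolding refines_def covers_def contained_iff list_all_iff list_ex_iff by blast

text \<open>A dropped set contains a kept one, and the condition on a set passes to subsets. In the
  induction the covering set is either in the accumulator or still to be processed.\<close>

lemma covers_minimals:
  assumes "covers F P"
  shows "covers (minimals F) P"
proof -
  define upd where "upd = (\<lambda>S G. if list_ex (\<lambda>T. contained T S) G then G else S # filter (\<lambda>T. \<not> contained S T) G :: (nat \<times> nat) list list)"
  have 1: "covers (upd S G) P" if "covers G P \<or> (\<forall>s\<in>set S. P s)" for S G
  proof (cases "list_ex (\<lambda>T. contained T S) G")
    case True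
    with that show ?thesis unfolding upd_def covers_def list_ex_iff contained_iff by auto
  next
    case False
    with that show ?thesis unfolding upd_def covers_def contained_iff by auto
  qed
  have "covers (fold upd F G) P" if "covers G P \<or> covers F P" for G
    using that
  proof (induction F arbitrary: G)
    case (Cons S F)
    then have "covers (upd S G) P \<or> covers F P"
      using 1[of G S] by (auto simp: covers_def)
    then show ?case using Cons.IH by simp
  qed (simp add: covers_def)
  then show ?thesis using assms unfolding minimals_def upd_def by blast
qed

lemma covers_next_family:
  assumes "covers F (reach mv me a p k)"
  shows "covers (next_family F) (reach mv me a p (Suc k))"
proof -
  obtain S where S: "S \<in> set F" "\<And>s. s \<in> set S \<Longrightarrow> reach mv me a p k s"
    using assms by (auto simp: covers_def)
  have "reach mv me a p (Suc k) s" if "s \<in> set (next_states (mv (Suc k)) (me (Suc k)) S)" for s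
    using that S(2) unfolding next_states_def by (auto split: if_splits intro: reach.step)
  moreover have "next_states (mv (Suc k)) (me (Suc k)) S \<in>
      set [next_states False False S, next_states False True S, next_states True False S, next_states True True S]"
    by (cases "mv (Suc k)"; cases "me (Suc k)") auto
  ultimately show ?thesis
    unfolding next_family_def using S(1)
    by (intro covers_minimals, unfold covers_def, intro bexI[of _ "next_states (mv (Suc k)) (me (Suc k)) S"])
      (auto simp del: set_simps)
qed

lemma covers_start: "covers [first_states a p False, first_states a p True] (reach mv me a p 0)"
proof -
  have "reach mv me a p 0 s" if "s \<in> set (first_states a p (me 0))" for s
    using that unfolding first_states_def by (auto split: if_splits intro: reach.start)
  then show ?thesis by (cases "me 0") (auto simp: covers_def)
qed

lemma covers_ends: "ends_in ts F \<Longrightarrow> covers F P \<Longrightarrow> t \<in> set ts \<Longrightarrow> P t"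
  unfolding ends_in_def covers_def list_all_iff contained_iff by blast

lemma in_set_concat_map: "x \<in> set xs \<Longrightarrow> y \<in> set (h x) \<Longrightarrow> y \<in> set (concat (map h xs))"
  by auto

text \<open>Two and three interior vertices are read off the computed families; from four on, an
  induction runs through \<open>full_family\<close>.\<close>

lemma reach_check:
  assumes "check a p" and "2 \<le> k"
  shows "(a, b, p, q) \<in> set promise_table \<Longrightarrow> reach mv me a p k (b, q)"
    and "(c, a) \<in> set gain_table \<Longrightarrow> p = c div 2 \<Longrightarrow> k \<noteq> 2 \<Longrightarrow> reach mv me a p k (a, c - p)"
proof -
  let ?F2 = "next_family (next_family [first_states a p False, first_states a p True])"
  let ?ts = "concat (map (\<lambda>(a', b, p', q). if a' = a \<and> p' = p then [(b, q)] else []) promise_table)"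
  let ?cs = "concat (map (\<lambda>(c, D). if D = a \<and> p \<le> c \<and> c \<le> p + 1 \<and> p * 2 \<le> c then [(D, c - p)] else []) gain_table)"
  have F2: "covers ?F2 (reach mv me a p 2)"
    unfolding numeral_2_eq_2 by (intro covers_next_family covers_start)
  have F3: "covers (next_family ?F2) (reach mv me a p 3)"
    using covers_next_family[OF F2] by (simp add: numeral_3_eq_3 numeral_2_eq_2)
  have ends: "ends_in ?ts ?F2" "ends_in ?ts (next_family ?F2)" "ends_in ?cs (next_family ?F2)"
    and full: "refines (next_family (next_family ?F2)) full_family"
    using assms(1) unfolding check_def check2_def check3_def check_full_def by auto
  have long: "covers full_family (reach mv me a p k)" if "4 \<le> k"
    using that
  proof (induction k rule: dec_induct)
    case base
    show ?case
      using covers_refines[OF full covers_next_family[OF F3]] by (simp add: numeral_eq_Suc)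
  next
    case (step k)
    show ?case
      using covers_refines[OF _ covers_next_family[OF step.IH]] check_full_full by (simp add: check_full_def)
  qed
  consider "k = 2" | "k = 3" | "4 \<le> k" using assms(2) by linarith
  note cases = this
  { assume "(a, b, p, q) \<in> set promise_table"
    then have 1: "(b, q) \<in> set ?ts" and
      2: "(b, q) \<in> set (concat (map (\<lambda>(a, b, p, q). [(b, q)]) promise_table))"
      by (rule in_set_concat_map, simp)+
    show "reach mv me a p k (b, q)"
      using cases
    proof cases
      case 1
      then show ?thesis using covers_ends[OF ends(1) F2] \<open>(b, q) \<in> set ?ts\<close> by blast
    next
      case 2
      then show ?thesis using covers_ends[OF ends(2) F3] \<open>(b, q) \<in> set ?ts\<close> by blast
    next
      case 3
      then show ?thesis using covers_ends[OF check_full_ends(1) long 2] by blast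
    qed }
  { assume c: "(c, a) \<in> set gain_table" and p: "p = c div 2" and "k \<noteq> 2"
    have "c \<le> 2" using c by (auto simp: gain_table_def)
    then have *: "p \<le> c \<and> c \<le> p + 1 \<and> p * 2 \<le> c" and
      e: "(if c < 2 then [(a, c)] else [(a, 1)]) = [(a, c - p)]"
      using p by auto
    have 1: "(a, c - p) \<in> set ?cs" by (rule in_set_concat_map[OF c]) (use * in simp)
    have 2: "(a, c - p) \<in> set (concat (map (\<lambda>(c, D). if c < 2 then [(D, c)] else [(D, 1)]) gain_table))"
      by (rule in_set_concat_map[OF c]) (simp only: prod.case e list.set insert_iff simp_thms)
    show "reach mv me a p k (a, c - p)"
    proof (cases "k = 3")
      case True
      then show ?thesis using covers_ends[OF ends(3) F3 1] by simp
    next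
      case False
      then have "4 \<le> k" using \<open>k \<noteq> 2\<close> assms(2) by linarith
      then show ?thesis using covers_ends[OF check_full_ends(2) long 2] by blast
    qed }
qed

section \<open>Properties of the tables\<close>

lemma check_promises: "(a, b, p, q) \<in> set promise_table \<Longrightarrow> check a p"
  using check_0_0 check_1_0 check_1_1 check_2_1 check_3_0 check_3_1 check_4_0 check_4_1
  by (auto simp: promise_table_def)

lemma check_gains: "(c, a) \<in> set gain_table \<Longrightarrow> check a (c div 2)"
  using check_0_0 check_1_0 check_3_0 check_4_0 check_4_1
  by (auto simp: gain_table_def)

lemma moves_unmarked: "(b, x, y) \<in> set (moves False a) \<longleftrightarrow> b \<le> 4 \<and> a \<noteq> b \<and> (x = 1 \<and> y = 0 \<or> x = 0 \<and> y = 1)"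
  unfolding moves_def if_False set_concat set_map set_upt by (auto split: if_splits)

lemma moves_marked: "(b, x, y) \<in> set (moves True a) \<longleftrightarrow>
    (\<exists>p q. (a, b, p, q) \<in> set promise_table \<and> (x = Suc p \<and> y = q \<or> x = p \<and> y = Suc q))"
  by (force simp: moves_def split: if_splits)

text \<open>Distinct in-degrees keep a marked edge proper; the symmetry allows an edge and its ear
  to be read from either end.\<close>

lemma check_table: "list_all (\<lambda>(a, b, p, q). List.member promise_table (b, a, q, p) \<and> a \<le> 4 \<and> a \<noteq> b) promise_table"
  by code_simp

lemma promises_sym: "(a, b, p, q) \<in> set promise_table \<Longrightarrow> (b, a, q, p) \<in> set promise_table"
  and promises_le: "(a, b, p, q) \<in> set promise_table \<Longrightarrow> a \<le> 4"
  and promises_distinct: "(a, b, p, q) \<in> set promise_table \<Longrightarrow> a \<noteq> b"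
  using check_table unfolding list_all_iff by auto

lemma moves_le: "(b, x, y) \<in> set (moves m a) \<Longrightarrow> b \<le> 4"
  using promises_le[OF promises_sym] by (cases m) (auto simp: moves_unmarked moves_marked)

lemma moves_sym: "(b, x, y) \<in> set (moves m a) \<Longrightarrow> a \<le> 4 \<Longrightarrow> (a, y, x) \<in> set (moves m b)"
  using promises_sym[of a b] by (cases m) (auto simp: moves_unmarked moves_marked)

lemma gains_zero: "(c, D) \<in> set gain_table \<Longrightarrow> (0, D) \<in> set gain_table"
  by (auto simp: gain_table_def)

definition labels :: "(nat \<Rightarrow> bool) \<Rightarrow> (nat \<Rightarrow> bool) \<Rightarrow> nat \<Rightarrow> (nat \<Rightarrow> nat) \<Rightarrow> (nat \<Rightarrow> nat) \<Rightarrow> (nat \<Rightarrow> nat) \<Rightarrow> bool" where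
  "labels mv me k d f g \<longleftrightarrow> (\<forall>i\<le>k. (d (Suc i), f i, g i) \<in> set (moves (me i) (d i))) \<and>
    (\<forall>i<k. g i + f (Suc i) \<le> d (Suc i) \<and>
       vert_ok (mv (Suc i)) (d (Suc i) - (g i + f (Suc i))) (d (Suc i)))"

lemma open_labels:
  assumes "(a, b, p, q) \<in> set promise_table" "2 \<le> k"
  obtains d f g where "labels mv me k d f g" "d 0 = a" "d (Suc k) = b" "f 0 = p" "g k = q"
proof -
  have "reach mv me a p k (b, q)"
    by (rule reach_check(1)[OF check_promises[OF assms(1)] assms(2,1)])
  from reach_labels[OF this] show thesis
    using that unfolding labels_def by auto
qed

lemma closed_labels:
  assumes "(c, a) \<in> set gain_table" "3 \<le> k"
  obtains d f g where "labels mv me k d f g" "d 0 = a" "d (Suc k) = a" "f 0 + g k = c"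
proof -
  have "reach mv me a (c div 2) k (a, c - c div 2)"
    using reach_check(2)[OF check_gains[OF assms(1)]] assms by simp
  from reach_labels[OF this] obtain d f g where
    "labels mv me k d f g" "d 0 = a" "d (Suc k) = a" "f 0 = c div 2" "g k = c - c div 2"
    unfolding labels_def by auto
  then show thesis using that by auto
qed

section \<open>Putting the ears back\<close>

context theta_free_graph
begin

lemma detour_sym: "detour S u v \<Longrightarrow> detour S v u"
proof -
  assume "detour S u v"
  moreover have "sym (Restr E S - {(u, v), (v, u)})" by (auto intro!: symI sym)
  ultimately have "(v, u) \<in> (Restr E S - {(u, v), (v, u)})\<^sup>*"
    unfolding detour_def by (metis symD sym_rtrancl)
  then show ?thesis unfolding detour_def by (simp only: insert_commute)
qed

text \<open>A detour through \<open>W\<close> enters and leaves it at \<open>u\<close> or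
  \<open>v\<close>, and the edge \<open>uv\<close> serves as a shortcut. Only for the edge
  \<open>uv\<close> itself is this shortcut forbidden, and there the detour is a hypothesis.\<close>

lemma bridgeless_remove:
  assumes "bridgeless_on V" "W \<subseteq> V" "nbrs V W \<subseteq> {u, v}"
    and uv: "u = v \<or> (u, v) \<in> E \<and> detour (V - W) u v"
  shows "bridgeless_on (V - W)"
  unfolding bridgeless_on_def
proof (intro ballI impI)
  fix a b assume ab: "a \<in> V - W" "b \<in> V - W" "(a, b) \<in> E"
  let ?R = "Restr E (V - W) - {(a, b), (b, a)}"
  have "sym ?R" using sym by (auto intro!: symI)
  show "detour (V - W) a b"
  proof (cases "{a, b} = {u, v} \<and> u \<noteq> v")
    case True
    then have "detour (V - W) u v" using uv by auto
    moreover have "a = u \<and> b = v \<or> a = v \<and> b = u" using True by (auto simp: doubleton_eq_iff)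
    ultimately show ?thesis using detour_sym by blast
  next
    case False
    have uvR: "(c, u) \<in> ?R\<^sup>* \<longleftrightarrow> (c, v) \<in> ?R\<^sup>*" if "u \<in> V - W" "v \<in> V - W" for c
    proof (cases "u = v")
      case False
      then have "(u, v) \<in> ?R" "(v, u) \<in> ?R" using that uv \<open>\<not> ({a, b} = {u, v} \<and> u \<noteq> v)\<close> sym by auto
      then show ?thesis by (meson rtrancl_into_rtrancl)
    qed simp
    have detour: "u \<noteq> v \<Longrightarrow> u \<in> V - W \<and> v \<in> V - W"
      using uv unfolding detour_def
      by (metis (no_types, lifting) DiffD1 IntD2 SigmaE2 converse_rtranclE rtranclE SigmaD1 SigmaD2)
    \<comment> \<open>While the walk is in \<open>W\<close>, both \<open>u\<close> and
      \<open>v\<close> must count as reached, since it may come out at either.\<close>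
    have "(z \<notin> W \<longrightarrow> (a, z) \<in> ?R\<^sup>*) \<and> (z \<in> W \<longrightarrow> (a, u) \<in> ?R\<^sup>* \<and> (a, v) \<in> ?R\<^sup>*)"
      if "(a, z) \<in> (Restr E V - {(a, b), (b, a)})\<^sup>*" for z
      using that
    proof induction
      case (step y z)
      then have yz: "(y, z) \<in> E" "y \<in> V" "z \<in> V" "(y, z) \<noteq> (a, b)" "(y, z) \<noteq> (b, a)" by auto
      consider "y \<notin> W" "z \<notin> W" | "y \<notin> W" "z \<in> W" | "y \<in> W" "z \<notin> W" | "y \<in> W" "z \<in> W" by blast
      then show ?case
      proof cases
        case 1
        then have "(y, z) \<in> ?R" using yz by auto
        then show ?thesis using 1 step.IH by (auto intro: rtrancl_into_rtrancl)
      next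
        case 2
        then have "y \<in> {u, v}" using assms(3) yz sym by (auto simp: nbrs_def)
        then show ?thesis using 2 step.IH uvR[of a] detour by auto
      next
        case 3
        then have "z \<in> {u, v}" using assms(3) yz by (auto simp: nbrs_def)
        then show ?thesis using 3 step.IH by auto
      next
        case 4
        then show ?thesis using step.IH by auto
      qed
    qed (use ab in auto)
    moreover have "detour V a b" using assms(1) ab by (auto simp: bridgeless_on_def)
    ultimately show ?thesis using ab unfolding detour_def by blast
  qed
qed

text \<open>
  \<open>w y z\<close> and \<open>c z\<close> are the contributions to the in-degree \<open>D z\<close> of the edge \<open>yz\<close> and of the ears promised at \<open>z\<close>.
\<close>

definition solution :: "'a set \<Rightarrow> ('a \<Rightarrow> bool) \<Rightarrow> ('a \<Rightarrow> 'a \<Rightarrow> bool) \<Rightarrow> ('a \<Rightarrow> nat) \<Rightarrow> ('a \<Rightarrow> 'a \<Rightarrow> nat) \<Rightarrow> ('a \<Rightarrow> nat) \<Rightarrow> bool"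
  where "solution V mv me D w c \<longleftrightarrow>
    (\<forall>z\<in>V. D z \<le> 4 \<and> vert_ok (mv z) (c z) (D z) \<and> D z = c z + (\<Sum>y\<in>{y\<in>V. (y, z) \<in> E}. w y z)) \<and>
    (\<forall>y\<in>V. \<forall>z\<in>V. (y, z) \<in> E \<longrightarrow> (D z, w z y, w y z) \<in> set (moves (me y z) (D y)))"

text \<open>\<open>D0\<close> already includes what the ear is to deliver. In \<open>sum\<close> the
  terms \<open>f 0\<close> and \<open>g k\<close> are the part missing from \<open>w0\<close> and
  \<open>c0\<close>, which the end edges of the ear now provide; they are separate summands because
  the ends may coincide.\<close>

lemma attach_ear:
  assumes fin: "finite V"
    and ear: "2 \<le> k" "inj_on x {1..k}" "W = x ` {1..k}" "W \<subseteq> V" "x 0 \<in> V - W" "x (Suc k) \<in> V - W"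
    and nb: "\<And>i y. 1 \<le> i \<Longrightarrow> i \<le> k \<Longrightarrow> y \<in> V \<Longrightarrow> (x i, y) \<in> E \<longleftrightarrow> y = x (i - 1) \<or> y = x (Suc i)"
    and me: "\<And>y z. me y z \<Longrightarrow> me z y"
    and lab: "labels (\<lambda>i. mv (x i)) (\<lambda>i. me (x i) (x (Suc i))) k d f g" "d 0 = D0 (x 0)" "d (Suc k) = D0 (x (Suc k))"
    and V': "\<And>z. z \<in> V - W \<Longrightarrow> D0 z \<le> 4 \<and> vert_ok (mv z) (c0 z) (D0 z)"
    and sum: "\<And>z. z \<in> V - W \<Longrightarrow> D0 z = c0 z + (\<Sum>y\<in>{y\<in>V - W. (y, z) \<in> E}. w0 y z)
        + (if z = x 0 then f 0 else 0) + (if z = x (Suc k) then g k else 0)"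
    and edges: "\<And>y z. y \<in> V - W \<Longrightarrow> z \<in> V - W \<Longrightarrow> (y, z) \<in> E \<Longrightarrow>
        (D0 z, w0 z y, w0 y z) \<in> set (moves (me y z) (D0 y))"
  shows "\<exists>D w c. solution V mv me D w c"
proof -
  define idx where "idx = inv_into {1..k} x"
  have idx: "idx (x i) = i" if "1 \<le> i" "i \<le> k" for i
    unfolding idx_def using ear(2) that by (intro inv_into_f_f) auto
  have xW: "x i \<in> W" if "1 \<le> i" "i \<le> k" for i using that ear(3) by auto
  have inj: "x i = x j \<longleftrightarrow> i = j" if "1 \<le> i" "i \<le> k" "1 \<le> j" "j \<le> k" for i j
    using inj_on_eq_iff[OF ear(2)] that by simp
  have xV: "x i \<in> V" if "i \<le> Suc k" for i
    using that xW[of i] ear(4-6) by (cases "i = 0"; cases "i = Suc k") auto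
  define D where "D = (\<lambda>z. if z \<in> W then d (idx z) else D0 z)"
  define c where "c = (\<lambda>z. if z \<in> W then d (idx z) - (g (idx z - 1) + f (idx z)) else c0 z)"
  \<comment> \<open>Only the two end edges of the ear run from \<open>W\<close> to the rest. They
    appear as a sum of two terms so that their contributions at \<open>z\<close> can be added up
    separately, even if \<open>x 0 = x (Suc k)\<close>.\<close>
  define w where "w = (\<lambda>y z. if z \<in> W then if y = x (idx z - 1) then g (idx z - 1) else f (idx z)
     else if y \<in> W then (if y = x 1 then if z = x 0 then f 0 else 0 else 0) +
        (if y = x k then if z = x (Suc k) then g k else 0 else 0) else w0 y z)"
  have D: "D (x i) = d i" if "i \<le> Suc k" for i
    using that xW[of i] idx[of i] ear(5,6) lab(2,3) by (cases "i = 0"; cases "i = Suc k") (auto simp: D_def)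
  have x1k: "x 1 \<noteq> x k" using inj[of 1 k] ear(1) by auto
  have wg: "w (x i) (x (Suc i)) = g i" if "i \<le> k" for i
  proof (cases "i = k")
    case True
    then show ?thesis using ear(1,6) xW[of k] x1k by (auto simp: w_def)
  next
    case False
    then show ?thesis using that idx[of "Suc i"] xW[of "Suc i"] by (auto simp: w_def)
  qed
  \<comment> \<open>The two neighbours of an ear vertex differ, even if the ends coincide; otherwise
    \<open>w\<close> could not tell the two edges at it apart.\<close>
  have x2: "x (Suc i) \<noteq> x (i - 1)" if "1 \<le> i" "i \<le> k" for i
  proof (cases "i = 1")
    case True
    then show ?thesis using xW[of 2] ear(1,5) by (auto simp: numeral_2_eq_2)
  next
    case F: False
    show ?thesis
    proof (cases "i = k")
      case True
      then show ?thesis using xW[of "i - 1"] ear(1,6) F that by auto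
    next
      case False
      then show ?thesis using inj[of "Suc i" "i - 1"] F that by auto
    qed
  qed
  have wf: "w (x (Suc i)) (x i) = f i" if "i \<le> k" for i
  proof (cases "i = 0")
    case True
    then show ?thesis using ear(1,5) xW[of 1] x1k by (auto simp: w_def)
  next
    case False
    then show ?thesis using that idx[of i] xW[of i] x2[of i] by (auto simp: w_def)
  qed
  have d4: "d i \<le> 4" if "i \<le> Suc k" for i
    using that lab V'[OF ear(5)] moves_le by (cases i) (auto simp: labels_def)
  have fwd: "(D (x (Suc i)), w (x (Suc i)) (x i), w (x i) (x (Suc i))) \<in> set (moves (me (x i) (x (Suc i))) (D (x i)))"
    if "i \<le> k" for i
    using that lab(1) by (simp add: labels_def D wf wg)
  have me': "me y z = me z y" for y z using me by blast
  have bwd: "(D (x i), w (x i) (x (Suc i)), w (x (Suc i)) (x i)) \<in> set (moves (me (x (Suc i)) (x i)) (D (x (Suc i))))"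
    if "i \<le> k" for i
    using moves_sym[OF fwd[OF that]] d4[of i] that D[of i] me'[of "x (Suc i)"] by simp
  have "solution V mv me D w c"
    unfolding solution_def
  proof (intro conjI ballI impI)
    fix z assume z: "z \<in> V"
    have "D z \<le> 4 \<and> vert_ok (mv z) (c z) (D z) \<and> D z = c z + (\<Sum>y\<in>{y\<in>V. (y, z) \<in> E}. w y z)"
    proof (cases "z \<in> W")
      case True
      then obtain i where i: "1 \<le> i" "i \<le> k" "z = x i" using ear(3) by auto
      have "{y \<in> V. (y, z) \<in> E} = {x (i - 1), x (Suc i)}"
        using nb[OF i(1,2)] xV[of "i - 1"] xV[of "Suc i"] i sym by auto
      then have "(\<Sum>y\<in>{y\<in>V. (y, z) \<in> E}. w y z) = g (i - 1) + f i"
        using x2[OF i(1,2)] wg[of "i - 1"] wf[of i] i by auto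
      moreover have "g (i - 1) + f i \<le> d i \<and> vert_ok (mv (x i)) (d i - (g (i - 1) + f i)) (d i)"
        using lab(1) i(1,2) unfolding labels_def by (metis One_nat_def Suc_le_D Suc_le_eq diff_Suc_1)
      moreover have "c z = d i - (g (i - 1) + f i)" using True i idx by (simp add: c_def)
      ultimately show ?thesis using D[of i] d4[of i] i by simp
    next
      case False
      have "{y \<in> V. (y, z) \<in> E} = {y \<in> V - W. (y, z) \<in> E} \<union> {y \<in> W. (y, z) \<in> E}" using ear(4) by auto
      then have "(\<Sum>y\<in>{y\<in>V. (y, z) \<in> E}. w y z) =
          (\<Sum>y\<in>{y \<in> V - W. (y, z) \<in> E}. w y z) + (\<Sum>y\<in>{y \<in> W. (y, z) \<in> E}. w y z)"
        using fin finite_subset[OF ear(4)] by (simp add: sum.union_disjoint disjoint_iff)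
      also have "(\<Sum>y\<in>{y \<in> V - W. (y, z) \<in> E}. w y z) = (\<Sum>y\<in>{y \<in> V - W. (y, z) \<in> E}. w0 y z)"
        using False by (intro sum.cong) (auto simp: w_def)
      also have "(\<Sum>y\<in>{y \<in> W. (y, z) \<in> E}. w y z) =
          (\<Sum>y\<in>{y \<in> W. (y, z) \<in> E}. if y = x 1 then if z = x 0 then f 0 else 0 else 0) +
          (\<Sum>y\<in>{y \<in> W. (y, z) \<in> E}. if y = x k then if z = x (Suc k) then g k else 0 else 0)"
        unfolding sum.distrib[symmetric] using False by (intro sum.cong) (auto simp: w_def)
      also have "\<dots> = (if z = x 0 then f 0 else 0) + (if z = x (Suc k) then g k else 0)"
      proof -
        have "finite {y \<in> W. (y, z) \<in> E}" using finite_subset[OF ear(4) fin] by simp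
        moreover have "x 1 \<in> W" "x k \<in> W" using xW ear(1) by auto
        moreover have "z = x 0 \<Longrightarrow> (x 1, z) \<in> E" "z = x (Suc k) \<Longrightarrow> (x k, z) \<in> E"
          using nb[of 1 z] nb[of k z] z ear(1) by auto
        ultimately show ?thesis by (simp add: sum.delta)
      qed
      finally show ?thesis using False z V'[of z] sum[of z] by (simp add: D_def c_def)
    qed
    then show "D z \<le> 4" "vert_ok (mv z) (c z) (D z)" "D z = c z + (\<Sum>y\<in>{y\<in>V. (y, z) \<in> E}. w y z)" by auto
  next
    fix y z assume yz: "y \<in> V" "z \<in> V" "(y, z) \<in> E"
    consider "y \<in> W" | "z \<in> W" | "y \<in> V - W" "z \<in> V - W" using yz by blast
    then show "(D z, w z y, w y z) \<in> set (moves (me y z) (D y))"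
    proof cases
      case 1
      then obtain i where i: "1 \<le> i" "i \<le> k" "y = x i" using ear(3) by auto
      then have "z = x (i - 1) \<or> z = x (Suc i)" using nb yz by blast
      then show ?thesis using fwd[of i] bwd[of "i - 1"] i by auto
    next
      case 2
      then obtain i where i: "1 \<le> i" "i \<le> k" "z = x i" using ear(3) by auto
      then have "y = x (i - 1) \<or> y = x (Suc i)" using nb yz sym by blast
      then show ?thesis using fwd[of "i - 1"] bwd[of i] i by auto
    next
      case 3
      then show ?thesis using edges[OF 3 yz(3)] by (simp add: D_def w_def)
    qed
  qed
  then show ?thesis by blast
qed

text \<open>This yields the third path of a theta on an edge \<open>uv\<close> with two ears: an
  induced cycle through \<open>uv\<close> without that edge. Its interior is nonempty by
  triangle-freeness.\<close>

lemma detour_link: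
  assumes "detour S u v" "(u, v) \<in> E" "u \<in> S" "v \<in> S"
  shows "link E u v (S - {u, v})"
proof -
  obtain x m where x: "induced_cycle x m" "x 0 = u" "x m = v" "x ` {..m} \<subseteq> S"
    using induced_cycle_exists[OF assms(2-4,1)] .
  have m3: "3 \<le> m" using x(1) by (simp add: induced_cycle_def)
  have e: "(x l, x (Suc l)) \<in> E" if "l < m" for l
    using x(1) that unfolding induced_cycle_def by (metis Suc_leI lessI)
  have inS: "x l \<in> S - {u, v}" if "1 \<le> l" "l < m" for l
  proof -
    have "x l \<in> S" using x(4) that by auto
    moreover have "x l \<noteq> x 0" "x l \<noteq> x m" using x(1) that by (auto simp: induced_cycle_def inj_on_def)
    ultimately show ?thesis using x(2,3) by auto
  qed
  have "(x 1, x (m - 1)) \<in> (Restr E (S - {u, v}))\<^sup>*"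
  proof (rule rtrancl_chain)
    fix l assume "1 \<le> l" "l < m - 1"
    then show "(x l, x (Suc l)) \<in> Restr E (S - {u, v})" using e[of l] inS[of l] inS[of "Suc l"] by auto
  qed (use m3 in auto)
  moreover have "(u, x 1) \<in> E" "(x (m - 1), v) \<in> E" using e[of 0] e[of "m - 1"] x(2,3) m3 by auto
  moreover have "x 1 \<in> S - {u, v}" "x (m - 1) \<in> S - {u, v}" using inS m3 by auto
  ultimately show ?thesis unfolding link_def by blast
qed

text \<open>The last assumption lets a second ear on a marked edge produce a theta.\<close>

lemma solution_exists:
  assumes "finite V0" "V \<subseteq> V0" "bridgeless_on V" "\<And>y z. me y z \<Longrightarrow> me z y"
    and "\<And>y z. y \<in> V \<Longrightarrow> z \<in> V \<Longrightarrow> me y z \<Longrightarrow> link E y z (V0 - V)"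
  shows "\<exists>D w c. solution V mv me D w c"
  using assms(2-)
proof (induction "card V" arbitrary: V mv me rule: less_induct)
  case less
  have fin: "finite V" using less.prems(1) assms(1) finite_subset by blast
  show ?case
  proof (cases "V = {}")
    case True
    then have "solution V mv me D w c" for D w c by (simp add: solution_def)
    then show ?thesis by blast
  next
    case False
    from fin False less.prems(2) show ?thesis
    proof (cases rule: ear_exists)
      case (isolated v)
      have nb: "nbrs V {v} = {}" using isolated by (auto simp: nbrs_def)
      have "\<exists>D w c. solution (V - {v}) mv me D w c"
      proof (rule less.hyps)
        show "card (V - {v}) < card V" using fin isolated(1) by (rule card_Diff1_less)
        show "bridgeless_on (V - {v})"
          using bridgeless_remove[OF less.prems(2), of "{v}" v v] isolated nb by auto
        fix y z assume yz: "y \<in> V - {v}" "z \<in> V - {v}" "me y z"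
        then have "link E y z (V0 - V)" using less.prems(4) by auto
        then show "link E y z (V0 - (V - {v}))" by (rule link_mono) auto
      qed (use less.prems in auto)
      then obtain D w c where s: "solution (V - {v}) mv me D w c" by blast
      have N: "{y \<in> V. (y, z) \<in> E} = {y \<in> V - {v}. (y, z) \<in> E}" if "z \<in> V" for z
        using isolated(2)[OF that] by auto
      have Nv: "{y \<in> V. (y, v) \<in> E} = {}" using isolated(2) sym by blast
      \<comment> \<open>In-degree 0 with no gain is admissible whether or not the vertex is
        marked.\<close>
      have v0: "vert_ok (mv v) 0 0" by (simp add: vert_ok_def gain_table_def)
      have sv: "D z \<le> 4 \<and> vert_ok (mv z) (c z) (D z) \<and> D z = c z + (\<Sum>y\<in>{y\<in>V. (y, z) \<in> E}. w y z)"
        if "z \<in> V" "z \<noteq> v" for z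
        using s that unfolding solution_def N[OF that(1)] by blast
      have se: "(D z, w z y, w y z) \<in> set (moves (me y z) (D y))" "y \<noteq> v" "z \<noteq> v"
        if "y \<in> V" "z \<in> V" "(y, z) \<in> E" for y z
        using s that isolated(2) sym unfolding solution_def by blast+
      have "solution V mv me (D(v := 0)) w (c(v := 0))"
        unfolding solution_def
      proof (intro conjI ballI impI)
        fix z assume z: "z \<in> V"
        have "(D(v := 0)) z \<le> 4 \<and> vert_ok (mv z) ((c(v := 0)) z) ((D(v := 0)) z) \<and>
          (D(v := 0)) z = (c(v := 0)) z + (\<Sum>y\<in>{y\<in>V. (y, z) \<in> E}. w y z)"
        proof (cases "z = v")
          case True
          show ?thesis using v0 unfolding True Nv by simp
        next
          case False
          show ?thesis unfolding fun_upd_other[OF False] by (rule sv[OF z False])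
        qed
        then show "(D(v := 0)) z \<le> 4" "vert_ok (mv z) ((c(v := 0)) z) ((D(v := 0)) z)"
          "(D(v := 0)) z = (c(v := 0)) z + (\<Sum>y\<in>{y\<in>V. (y, z) \<in> E}. w y z)" by blast+
      qed (use se in simp)
      then show ?thesis by blast
    next
      case (ear x k W)
      define u v where "u = x 0" and "v = x (Suc k)"
      have uv: "u \<in> V - W" "v \<in> V - W" using ear(5,6) by (simp_all add: u_def v_def)
      have x1: "x 1 \<in> W" "x k \<in> W" using ear(1,3) by auto
      have xV: "x i \<in> V" if "i \<le> Suc k" for i
        using that ear(3-6) by (cases "i = 0"; cases "i = Suc k") auto
      have nb: "nbrs V W \<subseteq> {u, v}"
      proof
        fix y assume y: "y \<in> nbrs V W"
        then obtain i where i: "1 \<le> i" "i \<le> k" "(x i, y) \<in> E" "y \<in> V - W" using ear(3) by (auto simp: nbrs_def)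
        then have "y = x (i - 1) \<or> y = x (Suc i)" using ear(7) by blast
        moreover have "x j \<in> W" if "1 \<le> j" "j \<le> k" for j using that ear(3) by auto
        ultimately show "y \<in> {u, v}"
          using i by (cases "i = 1"; cases "i = k") (auto simp: u_def v_def)
      qed
      have card: "card (V - W) < card V"
        using fin ear(4) x1 by (intro psubset_card_mono) auto
      have bl: "bridgeless_on (V - W)"
        using ear(8) nb by (intro bridgeless_remove[OF less.prems(2) ear(4), of u v]) (auto simp: u_def v_def)
      have link_W: "link E u v W"
      proof -
        have "(x 1, x k) \<in> (Restr E W)\<^sup>*"
        proof (rule rtrancl_chain)
          fix l assume l: "1 \<le> l" "l < k"
          then have "(x l, x (Suc l)) \<in> E" using ear(7)[of l "x (Suc l)"] xV by auto
          then show "(x l, x (Suc l)) \<in> Restr E W" using l ear(3) by auto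
        qed (use ear(1) in auto)
        moreover have "(u, x 1) \<in> E" "(x k, v) \<in> E"
          using ear(7)[of 1 u] ear(7)[of k v] sym uv ear(1) by (auto simp: u_def v_def)
        ultimately show ?thesis unfolding link_def using x1 by blast
      qed
      have old_link: "link E y z (V0 - (V - W))" if "y \<in> V - W" "z \<in> V - W" "me y z" for y z
      proof -
        have "link E y z (V0 - V)" using less.prems(4) that by auto
        then show ?thesis by (rule link_mono) auto
      qed
      note attach = attach_ear[OF fin ear(1-6), folded u_def v_def]
      show ?thesis
      proof (cases "u = v")
        case True
        then have k3: "3 \<le> k" using ear(8) irrefl by (auto simp: u_def v_def)
        have "\<exists>D w c. solution (V - W) (mv(u := True)) me D w c"
          using less.prems(1,3) old_link bl by (intro less.hyps card) auto
        then obtain D w c where s: "solution (V - W) (mv(u := True)) me D w c" by blast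
        have s': "D z \<le> 4" "vert_ok ((mv(u := True)) z) (c z) (D z)"
            "D z = c z + (\<Sum>y\<in>{y\<in>V - W. (y, z) \<in> E}. w y z)" if "z \<in> V - W" for z
          using s that unfolding solution_def by blast+
        have cu: "(c u, D u) \<in> set gain_table"
          using s'(2)[OF uv(1)] by (simp add: vert_ok_def)
        have s_edge: "(D z, w z y, w y z) \<in> set (moves (me y z) (D y))"
          if "y \<in> V - W" "z \<in> V - W" "(y, z) \<in> E" for y z
          using s that unfolding solution_def by blast
        \<comment> \<open>If \<open>u\<close> was already marked in \<open>V\<close>, its gain stays
          reserved for that mark and the present ear sends nothing, which \<open>gains_zero\<close>
          permits. Otherwise the ear uses up the whole gain.\<close>
        define h where "h = (if mv u then 0 else c u)"
        have h: "(h, D u) \<in> set gain_table" using cu gains_zero by (auto simp: h_def)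
        obtain d f g where lab: "labels (\<lambda>i. mv (x i)) (\<lambda>i. me (x i) (x (Suc i))) k d f g"
          "d 0 = D u" "d (Suc k) = D u" "f 0 + g k = h"
          by (rule closed_labels[OF h k3])
        show ?thesis
        proof (rule attach)
          show "labels (\<lambda>i. mv (x i)) (\<lambda>i. me (x i) (x (Suc i))) k d f g" by (rule lab(1))
          show "(x i, y) \<in> E \<longleftrightarrow> y = x (i - 1) \<or> y = x (Suc i)" if "1 \<le> i" "i \<le> k" "y \<in> V" for i y
            by (rule ear(7)[OF that])
          show "me z y" if "me y z" for y z by (rule less.prems(3)[OF that])
          show "D z \<le> 4 \<and> vert_ok (mv z) ((c(u := c u - h)) z) (D z)" if "z \<in> V - W" for z
            using s'(1,2)[OF that] by (auto simp: h_def vert_ok_def)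
          show "D z = (c(u := c u - h)) z + (\<Sum>y\<in>{y\<in>V - W. (y, z) \<in> E}. w y z) +
              (if z = u then f 0 else 0) + (if z = v then g k else 0)" if "z \<in> V - W" for z
            using s'(3)[OF that] lab(4) True by (auto simp: h_def)
        qed (use lab True s_edge in auto)
      next
        case False
        then have det: "(u, v) \<in> E" "detour (V - W) u v" using ear(8) by (auto simp: u_def v_def)
        \<comment> \<open>A marked \<open>uv\<close> would have three disjoint links: the earlier
          ear in \<open>V0 - V\<close>, the present one in \<open>W\<close>, and the detour in
          \<open>V - W\<close>.\<close>
        have unmarked: "\<not> me u v"
        proof
          assume "me u v"
          then have "link E u v (V0 - V)" using less.prems(4) uv by auto
          then show False
            using no_theta[OF False _ link_W detour_link[OF det(2,1) uv]] uv ear(4) by blast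
        qed
        define me' where "me' = (\<lambda>y z. me y z \<or> y = u \<and> z = v \<or> y = v \<and> z = u)"
        have "\<exists>D w c. solution (V - W) mv me' D w c"
        proof (rule less.hyps[OF card])
          fix y z assume yz: "y \<in> V - W" "z \<in> V - W" "me' y z"
          have "link E u v (V0 - (V - W))" using link_W less.prems(1) ear(4) by (elim link_mono) auto
          then show "link E y z (V0 - (V - W))"
            using yz old_link link_sym[OF sym_E] by (auto simp: me'_def)
        qed (use less.prems(1,3) bl in \<open>auto simp: me'_def\<close>)
        then obtain D w c where s: "solution (V - W) mv me' D w c" by blast
        have s': "D z \<le> 4" "vert_ok (mv z) (c z) (D z)"
            "D z = c z + (\<Sum>y\<in>{y\<in>V - W. (y, z) \<in> E}. w y z)" if "z \<in> V - W" for z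
          using s that unfolding solution_def by blast+
        have s_edge: "(D z, w z y, w y z) \<in> set (moves (me' y z) (D y))"
          if "y \<in> V - W" "z \<in> V - W" "(y, z) \<in> E" for y z
          using s that unfolding solution_def by blast
        have "(D v, w v u, w u v) \<in> set (moves True (D u))"
          using s_edge[OF uv det(1)] by (simp add: me'_def)
        then obtain p q where pq: "(D u, D v, p, q) \<in> set promise_table"
            "w v u = Suc p \<and> w u v = q \<or> w v u = p \<and> w u v = Suc q"
          by (auto simp: moves_marked)
        obtain d f g where lab: "labels (\<lambda>i. mv (x i)) (\<lambda>i. me (x i) (x (Suc i))) k d f g"
          "d 0 = D u" "d (Suc k) = D v" "f 0 = p" "g k = q"
          by (rule open_labels[OF pq(1) ear(1)])
        \<comment> \<open>Taking the shares \<open>p\<close> and \<open>q\<close> of the ear off the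
          marked edge leaves contributions 1 and 0 in some order, as for an unmarked edge.\<close>
        define w' where "w' = (\<lambda>y z. if y = v \<and> z = u then w y z - p else if y = u \<and> z = v then w y z - q else w y z)"
        have w'_sum: "(\<Sum>y\<in>{y\<in>V - W. (y, z) \<in> E}. w y z) = (\<Sum>y\<in>{y\<in>V - W. (y, z) \<in> E}. w' y z) +
              (if z = u then p else 0) + (if z = v then q else 0)" for z
        proof -
          let ?N = "{y\<in>V - W. (y, z) \<in> E}"
          have "(\<Sum>y\<in>?N. w y z) = (\<Sum>y\<in>?N. w' y z + (if y = v then if z = u then p else 0 else 0) +
              (if y = u then if z = v then q else 0 else 0))"
            using pq(2) False by (intro sum.cong) (auto simp: w'_def)
          also have "\<dots> = (\<Sum>y\<in>?N. w' y z) + (if z = u then p else 0) + (if z = v then q else 0)"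
            using fin uv det(1) sym[OF det(1)] by (auto simp: sum.distrib sum.delta)
          finally show ?thesis .
        qed
        show ?thesis
        proof (rule attach)
          show "labels (\<lambda>i. mv (x i)) (\<lambda>i. me (x i) (x (Suc i))) k d f g" by (rule lab(1))
          show "(x i, y) \<in> E \<longleftrightarrow> y = x (i - 1) \<or> y = x (Suc i)" if "1 \<le> i" "i \<le> k" "y \<in> V" for i y
            by (rule ear(7)[OF that])
          show "me z y" if "me y z" for y z by (rule less.prems(3)[OF that])
          show "D z \<le> 4 \<and> vert_ok (mv z) (c z) (D z)" if "z \<in> V - W" for z
            using s'[OF that] by auto
          show "D z = c z + (\<Sum>y\<in>{y\<in>V - W. (y, z) \<in> E}. w' y z) +
              (if z = u then f 0 else 0) + (if z = v then g k else 0)" if "z \<in> V - W" for z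
            using s'(3)[OF that] w'_sum[of z] lab(4,5) by simp
          fix y z assume yz: "y \<in> V - W" "z \<in> V - W" "(y, z) \<in> E"
          have ne: "D u \<noteq> D v" "D u \<le> 4" "D v \<le> 4" using promises_distinct[OF pq(1)] s'(1) uv by auto
          have unmarked': "\<not> me v u" using unmarked less.prems(3) by blast
          consider "y = u" "z = v" | "y = v" "z = u" | "\<not> (y = u \<and> z = v)" "\<not> (y = v \<and> z = u)" by blast
          then show "(D z, w' z y, w' y z) \<in> set (moves (me y z) (D y))"
          proof cases
            case 1
            then show ?thesis using pq(2) ne unmarked False by (auto simp: w'_def moves_unmarked)
          next
            case 2
            then show ?thesis using pq(2) ne unmarked' False by (auto simp: w'_def moves_unmarked)
          next
            case 3
            moreover from 3 have "\<not> (z = v \<and> y = u)" "\<not> (z = u \<and> y = v)" by blast+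
            ultimately have "me' y z = me y z" "w' y z = w y z" "w' z y = w z y"
              by (simp_all only: w'_def me'_def if_False simp_thms)
            then show ?thesis using s_edge[OF yz] by (simp only:)
          qed
        qed (use lab in auto)
      qed
    qed
  qed
qed

end

section \<open>From drawings to theta-free graphs\<close>

fun path_edges :: "'a list \<Rightarrow> 'a set set" where
  "path_edges (x # y # zs) = insert {x, y} (path_edges (y # zs))"
| "path_edges _ = {}"

lemma path_edges_subset: "e \<in> path_edges xs \<Longrightarrow> e \<subseteq> set xs"
  by (induction xs rule: path_edges.induct) auto

text \<open>Consequently paths with common ends and disjoint interiors have no edge in
  common.\<close>

lemma path_edges_interior:
  assumes "distinct (u # xs @ [v])" "xs \<noteq> []" "e \<in> path_edges (u # xs @ [v])"
  shows "\<exists>w\<in>set xs. w \<in> e"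
  using assms
proof (induction xs arbitrary: u)
  case (Cons x xs)
  show ?case
  proof (cases "xs = []")
    case True
    then show ?thesis using Cons.prems by auto
  next
    case False
    have "e = {u, x} \<or> e \<in> path_edges (x # xs @ [v])" using Cons.prems by simp
    then show ?thesis using Cons.IH[of x] Cons.prems False by auto
  qed
qed simp

lemma path_edges_uedges:
  "successively (\<lambda>x y. (x, y) \<in> parcs G) xs \<Longrightarrow> path_edges xs \<subseteq> uedges G"
  by (induction xs rule: path_edges.induct) (auto simp: uedges_def)

text \<open>\<open>\<gamma>\<close> draws undirected edges, so the given arc may run from
  \<open>p y\<close> to \<open>p x\<close> and then has to be reversed.\<close>

lemma edge_arc:
  assumes "planar_embedding G p \<gamma>" "(x, y) \<in> parcs G"
  obtains g where "arc g" "pathstart g = p x" "pathfinish g = p y" "path_image g = path_image (\<gamma> {x, y})"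
proof -
  have e: "{x, y} \<in> uedges G" using assms(2) by (auto simp: uedges_def)
  then have g: "arc (\<gamma> {x, y})" "{pathstart (\<gamma> {x, y}), pathfinish (\<gamma> {x, y})} = {p x, p y}"
    using assms(1) by (auto simp: planar_embedding_def)
  then consider "pathstart (\<gamma> {x, y}) = p x" "pathfinish (\<gamma> {x, y}) = p y"
    | "pathstart (\<gamma> {x, y}) = p y" "pathfinish (\<gamma> {x, y}) = p x" by (auto simp: doubleton_eq_iff)
  then show thesis
  proof cases
    case 1
    then show thesis using that g(1) by blast
  next
    case 2
    then show thesis using that[of "reversepath (\<gamma> {x, y})"] g(1) by (simp add: arc_reversepath)
  qed
qed

lemma edge_images_Int:
  assumes "planar_embedding G p \<gamma>" "e \<in> uedges G" "f \<in> uedges G" "e \<noteq> f"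
  shows "path_image (\<gamma> e) \<inter> path_image (\<gamma> f) \<subseteq> p ` (e \<inter> f)"
  using assms by (auto simp: planar_embedding_def)

text \<open>The first edge meets the later ones only in \<open>p y\<close>, because its start
  \<open>x\<close> is on none of them; so joining the arcs gives an arc.\<close>

lemma path_arc:
  assumes emb: "planar_embedding G p \<gamma>"
    and "distinct xs" "2 \<le> length xs" "successively (\<lambda>x y. (x, y) \<in> parcs G) xs"
  shows "\<exists>g. arc g \<and> pathstart g = p (hd xs) \<and> pathfinish g = p (last xs) \<and>
    path_image g = (\<Union>e\<in>path_edges xs. path_image (\<gamma> e))"
  using assms(2-)
proof (induction xs rule: path_edges.induct)
  case (1 x y zs)
  obtain g0 where g0: "arc g0" "pathstart g0 = p x" "pathfinish g0 = p y" "path_image g0 = path_image (\<gamma> {x, y})"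
    using edge_arc[OF emb, of x y] 1(4) by auto
  show ?case
  proof (cases zs)
    case Nil
    then show ?thesis using g0 by auto
  next
    case (Cons z zs')
    then obtain g1 where g1: "arc g1" "pathstart g1 = p y" "pathfinish g1 = p (last (y # zs))"
        "path_image g1 = (\<Union>e\<in>path_edges (y # zs). path_image (\<gamma> e))"
      using 1 by auto
    have "path_image (\<gamma> {x, y}) \<inter> path_image (\<gamma> e) \<subseteq> {p y}" if e: "e \<in> path_edges (y # zs)" for e
    proof -
      have "e \<subseteq> set (y # zs)" using e by (rule path_edges_subset)
      then have "x \<notin> e" using 1(2) by auto
      moreover have "e \<in> uedges G" "{x, y} \<in> uedges G"
        using path_edges_uedges[OF 1(4)] e by auto
      ultimately have "path_image (\<gamma> {x, y}) \<inter> path_image (\<gamma> e) \<subseteq> p ` ({x, y} \<inter> e)"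
        using edge_images_Int[OF emb, of "{x, y}" e] by auto
      then show ?thesis using \<open>x \<notin> e\<close> by auto
    qed
    then have "path_image g0 \<inter> path_image g1 \<subseteq> {pathstart g1}"
      using g0 g1 by auto
    then have "arc (g0 +++ g1)" using g0 g1 by (intro arc_join) auto
    moreover have "path_image (g0 +++ g1) = (\<Union>e\<in>path_edges (x # y # zs). path_image (\<gamma> e))"
      using g0 g1 by (simp add: path_image_join)
    ultimately show ?thesis using g0 g1 Cons by (intro exI[of _ "g0 +++ g1"]) auto
  qed
qed auto

lemma successively_map_upt:
  "(\<And>i. i < n \<Longrightarrow> P (f i) (f (Suc i))) \<Longrightarrow> successively P (map f [0..<Suc n])"
proof (induction n)
  case (Suc n)
  then have "successively P (map f [0..<Suc n])" by simp
  then have "successively P (map f [0..<Suc n] @ [f (Suc n)])"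
    using Suc.prems[of n] by (subst successively_append_iff) (simp add: last_map)
  then show ?case by simp
qed simp

lemma link_path:
  assumes "link E u v A" "u \<notin> A" "v \<notin> A" "u \<noteq> v"
  obtains xs where "distinct (u # xs @ [v])" "xs \<noteq> []" "set xs \<subseteq> A"
    "successively (\<lambda>x y. (x, y) \<in> E) (u # xs @ [v])"
proof -
  obtain a b where ab: "a \<in> A" "b \<in> A" "(u, a) \<in> E" "(a, b) \<in> (Restr E A)\<^sup>*" "(b, v) \<in> E"
    using assms(1) by (auto simp: link_def)
  obtain n f where f: "f 0 = a" "f n = b" "\<And>i. i < n \<Longrightarrow> (f i, f (Suc i)) \<in> Restr E A" "inj_on f {..n}"
    using ab(4) by (rule shortest_path) blast
  define xs where "xs = map f [0..<Suc n]"
  have xs: "xs \<noteq> []" "hd xs = a" "last xs = b"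
    using f(1,2) by (auto simp: xs_def hd_map last_map simp del: upt_Suc)
  have fA: "f i \<in> A" if "i \<le> n" for i
    using that f(1) f(3)[of "i - 1"] ab(1) by (cases i) auto
  then have "set xs \<subseteq> A" by (auto simp: xs_def)
  moreover have "distinct xs"
    using f(4) unfolding xs_def by (simp add: distinct_map atLeast0LessThan lessThan_Suc_atMost del: upt_Suc)
  moreover have "successively (\<lambda>x y. (x, y) \<in> E) xs"
    unfolding xs_def using f(3) by (intro successively_map_upt) auto
  then have "successively (\<lambda>x y. (x, y) \<in> E) (u # xs @ [v])"
    using ab(3,5) xs by (auto simp: successively_Cons successively_append_iff)
  ultimately show thesis using that[of xs] xs(1) assms(2-4) by auto
qed

text \<open>The links are drawn as three arcs from \<open>p u\<close> to \<open>p v\<close>. Edges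
  of different links are distinct and share at most \<open>u\<close> and \<open>v\<close>, so the
  arcs form a theta curve. A face with all vertices on its frontier would touch each open arc at the
  image of an interior vertex of its path.\<close>

lemma outerplanar_no_theta:
  assumes "outerplanar G" "parcs G \<subseteq> pverts G \<times> pverts G" "u \<noteq> v"
    and links: "link (parcs G) u v A" "link (parcs G) u v B" "link (parcs G) u v C"
    and disj: "A \<inter> B = {}" "A \<inter> C = {}" "B \<inter> C = {}" "{u, v} \<inter> (A \<union> B \<union> C) = {}"
  shows False
proof -
  obtain p \<gamma> F where emb: "planar_embedding G p \<gamma>" and F: "F \<in> faces G p \<gamma>" "p ` pverts G \<subseteq> frontier F"
    using assms(1) unfolding outerplanar_def by blast
  let ?im = "\<lambda>xs. \<Union>e\<in>path_edges xs. path_image (\<gamma> e)"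
  let ?P = "\<lambda>xs. distinct (u # xs @ [v]) \<and> xs \<noteq> [] \<and> successively (\<lambda>x y. (x, y) \<in> parcs G) (u # xs @ [v])"
  have out: "u \<notin> A" "v \<notin> A" "u \<notin> B" "v \<notin> B" "u \<notin> C" "v \<notin> C" using disj(4) by auto
  obtain xs where xs: "?P xs" "set xs \<subseteq> A"
    by (rule link_path[OF links(1) out(1,2) assms(3)]) blast
  obtain ys where ys: "?P ys" "set ys \<subseteq> B"
    by (rule link_path[OF links(2) out(3,4) assms(3)]) blast
  obtain zs where zs: "?P zs" "set zs \<subseteq> C"
    by (rule link_path[OF links(3) out(5,6) assms(3)]) blast
  note lists = xs ys zs
  have ex_arc: "\<exists>g. arc g \<and> pathstart g = p u \<and> pathfinish g = p v \<and> path_image g = ?im (u # xs @ [v])"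
    if "?P xs" for xs
    using path_arc[OF emb, of "u # xs @ [v]"] that by auto
  obtain g where g: "arc g" "pathstart g = p u" "pathfinish g = p v" "path_image g = ?im (u # xs @ [v])"
    using ex_arc[OF lists(1)] by blast
  obtain h where h: "arc h" "pathstart h = p u" "pathfinish h = p v" "path_image h = ?im (u # ys @ [v])"
    using ex_arc[OF lists(3)] by blast
  obtain k where k: "arc k" "pathstart k = p u" "pathfinish k = p v" "path_image k = ?im (u # zs @ [v])"
    using ex_arc[OF lists(5)] by blast
  have Int: "?im (u # xs @ [v]) \<inter> ?im (u # ys @ [v]) \<subseteq> {p u, p v}"
    if P: "?P xs" "?P ys" and d: "set xs \<inter> set ys = {}" for xs ys
  proof
    fix z assume "z \<in> ?im (u # xs @ [v]) \<inter> ?im (u # ys @ [v])"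
    then obtain e f where ef: "e \<in> path_edges (u # xs @ [v])" "z \<in> path_image (\<gamma> e)"
      "f \<in> path_edges (u # ys @ [v])" "z \<in> path_image (\<gamma> f)" by blast
    have sub: "e \<subseteq> {u, v} \<union> set xs" "f \<subseteq> {u, v} \<union> set ys"
      using path_edges_subset[OF ef(1)] path_edges_subset[OF ef(3)] by auto
    obtain w where w: "w \<in> set xs" "w \<in> e" using path_edges_interior[OF _ _ ef(1)] P by blast
    have "w \<notin> f" using w(1) sub(2) d P(1) by auto
    then have "e \<noteq> f" using w by blast
    moreover have "e \<in> uedges G" "f \<in> uedges G" using path_edges_uedges P ef by blast+
    ultimately have "z \<in> p ` (e \<inter> f)" using edge_images_Int[OF emb] ef(2,4) by blast
    moreover have "e \<inter> f \<subseteq> {u, v}" using sub d by auto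
    ultimately show "z \<in> {p u, p v}" by auto
  qed
  have "set xs \<inter> set ys = {}" "set xs \<inter> set zs = {}" "set ys \<inter> set zs = {}"
    using lists disj by blast+
  then have Ints: "path_image g \<inter> path_image h \<subseteq> {p u, p v}" "path_image g \<inter> path_image k \<subseteq> {p u, p v}"
    "path_image h \<inter> path_image k \<subseteq> {p u, p v}"
    using Int[OF lists(1,3)] Int[OF lists(1,5)] Int[OF lists(3,5)] g(4) h(4) k(4) by simp_all
  have ends: "{p u, p v} \<subseteq> path_image l" if "pathstart l = p u" "pathfinish l = p v" for l
    using pathstart_in_path_image[of l] pathfinish_in_path_image[of l] that by auto
  have eqs: "path_image g \<inter> path_image h = {p u, p v}" "path_image g \<inter> path_image k = {p u, p v}"
    "path_image h \<inter> path_image k = {p u, p v}"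
    by (intro subset_antisym Int_greatest Ints ends g(2,3) h(2,3) k(2,3))+
  interpret theta_curve g h k "p u" "p v"
    by unfold_locales (fact g h k eqs)+
  have F': "F \<noteq> {}" "topological_space_class.connected F" "F \<inter> drawing G p \<gamma> = {}"
    using F(1) in_components_nonempty in_components_connected in_components_subset unfolding faces_def by blast+
  have im_sub: "?im (u # xs @ [v]) \<subseteq> drawing G p \<gamma>" if "?P xs" for xs
    using path_edges_uedges[of G "u # xs @ [v]"] that unfolding drawing_def by blast
  have meets: "closure F \<inter> (?im (u # xs @ [v]) - {p u, p v}) \<noteq> {}" if P: "?P xs" for xs
  proof -
    obtain w ws where xs: "xs = w # ws" using P by (cases xs) auto
    have e: "(u, w) \<in> parcs G" "{u, w} \<in> path_edges (u # xs @ [v])" using P xs by auto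
    then have "{u, w} \<in> uedges G" by (auto simp: uedges_def)
    then have "path_image (\<gamma> {u, w}) \<inter> p ` pverts G = p ` {u, w}"
      using emb by (auto simp: planar_embedding_def)
    then have "p w \<in> ?im (u # xs @ [v])" using e(2) by blast
    moreover have V: "w \<in> pverts G" "u \<in> pverts G" using e(1) assms(2) by auto
    moreover have "v \<in> pverts G"
    proof -
      have "(last (u # xs), v) \<in> parcs G"
        using P by (simp add: successively_append_iff split: if_splits flip: append_Cons)
      then show ?thesis using assms(2) by auto
    qed
    then have "p w \<noteq> p u" "p w \<noteq> p v"
      using emb V P xs by (auto simp: planar_embedding_def dest: inj_onD)
    moreover have "p w \<in> closure F" using F(2) V(1) by (auto simp: frontier_def)
    ultimately show ?thesis by blast
  qed
  have "closure F \<inter> (path_image g - {p u, p v}) \<noteq> {}" unfolding g(4) by (rule meets[OF lists(1)])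
  moreover have "closure F \<inter> (path_image h - {p u, p v}) \<noteq> {}" unfolding h(4) by (rule meets[OF lists(3)])
  moreover have "closure F \<inter> (path_image k - {p u, p v}) \<noteq> {}" unfolding k(4) by (rule meets[OF lists(5)])
  moreover have "F \<inter> (path_image g \<union> path_image h \<union> path_image k) = {}"
    using F'(3) im_sub[OF lists(1)] im_sub[OF lists(3)] im_sub[OF lists(5)] unfolding g(4) h(4) k(4) by blast
  ultimately show False by (intro no_common_face[OF F'(1,2)])
qed

section \<open>Bridges\<close>

lemma sccs_verts_symmetric:
  fixes H :: "'a pair_pre_digraph"
  assumes sub: "parcs H \<subseteq> pverts H \<times> pverts H" and "sym (parcs H)"
  shows "pre_digraph.sccs_verts (with_proj H) = (\<lambda>u. {v. (u, v) \<in> (parcs H)\<^sup>*}) ` pverts H"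
proof -
  have in_V: "v \<in> pverts H" if "(u, v) \<in> (parcs H)\<^sup>*" "u \<in> pverts H" for u v
    using that by (induction rule: rtrancl_induct) (use sub in auto)
  have reach: "reachable (with_proj H) u v \<longleftrightarrow> u \<in> pverts H \<and> (u, v) \<in> (parcs H)\<^sup>*" for u v
  proof
    assume "reachable (with_proj H) u v"
    then have "(u, v) \<in> rtrancl_on (pverts H) (parcs H)" by (simp add: reachable_def)
    then show "u \<in> pverts H \<and> (u, v) \<in> (parcs H)\<^sup>*"
      by (auto dest: in_rtrancl_on_in_F rtrancl_on_rtranclI)
  next
    assume "u \<in> pverts H \<and> (u, v) \<in> (parcs H)\<^sup>*"
    then have "(u, v) \<in> (parcs H)\<^sup>*" "u \<in> pverts H" by auto
    then show "reachable (with_proj H) u v"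
      unfolding reachable_def
    proof induction
      case (step y z)
      then show ?case using sub by (auto intro: rtrancl_on_into_rtrancl_on)
    qed simp
  qed
  have symr: "(v, u) \<in> (parcs H)\<^sup>*" if "(u, v) \<in> (parcs H)\<^sup>*" for u v
    using that assms(2) by (metis symD sym_rtrancl)
  show ?thesis
  proof (intro equalityI subsetI)
    fix S assume "S \<in> pre_digraph.sccs_verts (with_proj H)"
    then have S: "S \<noteq> {}" "\<And>u v. u \<in> S \<Longrightarrow> v \<in> S \<Longrightarrow> u \<in> pverts H \<and> (u, v) \<in> (parcs H)\<^sup>*"
      "\<And>u v. u \<in> S \<Longrightarrow> v \<notin> S \<Longrightarrow> \<not> (u \<in> pverts H \<and> (u, v) \<in> (parcs H)\<^sup>*) \<or> \<not> (v \<in> pverts H \<and> (v, u) \<in> (parcs H)\<^sup>*)"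
      unfolding pre_digraph.sccs_verts_def reach by blast+
    obtain u where u: "u \<in> S" using S(1) by blast
    then have uV: "u \<in> pverts H" using S(2) by blast
    have "S = {v. (u, v) \<in> (parcs H)\<^sup>*}"
      using S(2)[OF u] S(3)[OF u] in_V symr uV by blast
    then show "S \<in> (\<lambda>u. {v. (u, v) \<in> (parcs H)\<^sup>*}) ` pverts H" using uV by blast
  next
    fix S assume "S \<in> (\<lambda>u. {v. (u, v) \<in> (parcs H)\<^sup>*}) ` pverts H"
    then obtain u where u: "u \<in> pverts H" "S = {v. (u, v) \<in> (parcs H)\<^sup>*}" by blast
    have "u \<in> S" using u by simp
    moreover have "x \<in> pverts H \<and> (x, y) \<in> (parcs H)\<^sup>*" if "x \<in> S" "y \<in> S" for x y
      using that u in_V symr by (blast intro: rtrancl_trans)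
    moreover have "\<not> (x, y) \<in> (parcs H)\<^sup>*" if "x \<in> S" "y \<notin> S" for x y
      using that u by (auto dest: rtrancl_trans)
    ultimately show "S \<in> pre_digraph.sccs_verts (with_proj H)"
      unfolding pre_digraph.sccs_verts_def reach by blast
  qed
qed

text \<open>Sending each class after the deletion to the class that contains it before is onto. It
  is not injective if \<open>u\<close> and \<open>v\<close> are separated, as their classes have the
  same image; so the number of components grows.\<close>

lemma bridgeI:
  fixes G :: "'a pair_pre_digraph"
  assumes "pair_graph G" "(u, v) \<in> parcs G" "(u, v) \<notin> (parcs G - {(u, v), (v, u)})\<^sup>*"
  shows "bridge G u v"
proof -
  interpret pair_graph G by fact
  let ?H = "delete_edge G u v"
  let ?cl = "\<lambda>r u. {v. (u, v) \<in> r\<^sup>*}"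
  let ?r = "parcs G" and ?r' = "parcs G - {(u, v), (v, u)}"
  have H: "pverts ?H = pverts G" "parcs ?H = ?r'" by (simp_all add: delete_edge_def)
  have sub: "parcs G \<subseteq> pverts G \<times> pverts G" using wellformed by (auto simp: wellformed')
  have symG: "sym ?r" "sym ?r'" using arcs_symmetric by (auto intro!: symI)
  define \<phi> where "\<phi> = (\<lambda>S. \<Union>x\<in>S. ?cl ?r x)"
  have \<phi>: "\<phi> (?cl ?r' x) = ?cl ?r x" for x
  proof -
    have "?r'\<^sup>* \<subseteq> ?r\<^sup>*" by (rule rtrancl_mono) auto
    then show ?thesis unfolding \<phi>_def by (auto intro: rtrancl_trans)
  qed
  have eq: "\<phi> ` (?cl ?r' ` pverts G) = ?cl ?r ` pverts G"
    by (simp add: image_image \<phi>)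
  have uv: "u \<in> pverts G" "v \<in> pverts G" using assms(2) sub by auto
  have cl_eq: "?cl ?r u = ?cl ?r v"
    using assms(2) arcs_symmetric by (auto intro: converse_rtrancl_into_rtrancl)
  have "\<not> inj_on \<phi> (?cl ?r' ` pverts G)"
  proof
    assume inj: "inj_on \<phi> (?cl ?r' ` pverts G)"
    have "\<phi> (?cl ?r' u) = \<phi> (?cl ?r' v)" unfolding \<phi> by (rule cl_eq)
    then have "?cl ?r' u = ?cl ?r' v" by (rule inj_onD[OF inj]) (use uv in blast)+
    then show False using assms(3) by blast
  qed
  then have "card (?cl ?r ` pverts G) < card (?cl ?r' ` pverts G)"
    unfolding eq[symmetric] using finite_verts
    by (metis card_image_le eq_card_imp_inj_on finite_imageI le_neq_implies_less)
  moreover have "pre_digraph.sccs_verts (with_proj G) = ?cl ?r ` pverts G"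
    by (rule sccs_verts_symmetric[OF sub symG(1)])
  moreover have "pre_digraph.sccs_verts (with_proj ?H) = ?cl ?r' ` pverts G"
    using sccs_verts_symmetric[of ?H, unfolded H] sub symG(2) by blast
  ultimately show ?thesis
    unfolding bridge_def num_components_def using assms(2) by simp
qed

section \<open>The bound for the whole graph\<close>

theorem theorem2:
  fixes G :: "'a pair_pre_digraph"
  assumes "pair_graph G"
    and "triangle_free G"
    and "bridgeless G"
    and "outerplanar G"
  shows "proper_orientation_number G \<le> 4"
proof -
  interpret pair_graph G by fact
  have wf: "parcs G \<subseteq> pverts G \<times> pverts G" using wellformed by (auto simp: wellformed')
  interpret T: theta_free_graph "parcs G"
  proof
    show "(y, x) \<in> parcs G" if "(x, y) \<in> parcs G" for x y using that by (rule arcs_symmetric)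
    show "(x, x) \<notin> parcs G" for x using pair_no_loops by force
    show "(z, x) \<notin> parcs G" if "(x, y) \<in> parcs G" "(y, z) \<in> parcs G" for x y z
      using that assms(2) unfolding triangle_free_def by blast
  qed (rule outerplanar_no_theta[OF assms(4) wf])
  have "T.bridgeless_on (pverts G)"
    unfolding T.bridgeless_on_def T.detour_def
  proof (intro ballI impI)
    fix a b assume "(a, b) \<in> parcs G"
    then have "(a, b) \<in> (parcs G - {(a, b), (b, a)})\<^sup>*"
      using bridgeI[OF assms(1)] assms(3) by (auto simp: bridgeless_def)
    moreover have "Restr (parcs G) (pverts G) = parcs G" using wf by blast
    ultimately show "(a, b) \<in> (Restr (parcs G) (pverts G) - {(a, b), (b, a)})\<^sup>*" by simp
  qed
  \<comment> \<open>Without marks nothing is promised: \<open>c\<close> vanishes, each edge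
    contributes 1 to exactly one end, and \<open>d\<close> gives the in-degrees of the orientation
    described by \<open>w\<close>.\<close>
  then obtain d w c where sol: "T.solution (pverts G) (\<lambda>_. False) (\<lambda>_ _. False) d w c"
    using T.solution_exists[OF finite_verts subset_refl, of "\<lambda>_ _. False" "\<lambda>_. False"] by auto
  have edge: "d x \<noteq> d y \<and> (w y x = 1 \<and> w x y = 0 \<or> w y x = 0 \<and> w x y = 1)" if "(x, y) \<in> parcs G" for x y
  proof -
    have "x \<in> pverts G" "y \<in> pverts G" using that wf by auto
    then have "(d y, w y x, w x y) \<in> set (moves False (d x))" using sol that by (auto simp: T.solution_def)
    then show ?thesis by (auto simp: moves_unmarked)
  qed
  define D where "D = \<lparr>pverts = pverts G, parcs = {(x, y) \<in> parcs G. w x y = 1}\<rparr>"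
  have D: "pverts D = pverts G" "parcs D = {(x, y) \<in> parcs G. w x y = 1}" by (simp_all add: D_def)
  have deg: "in_degree (with_proj D) z = d z \<and> d z \<le> 4" if "z \<in> pverts G" for z
  proof -
    let ?N = "{y \<in> pverts G. (y, z) \<in> parcs G}"
    have "in_arcs (with_proj D) z = (\<lambda>y. (y, z)) ` {y \<in> ?N. w y z = 1}"
      using wf by (auto simp: in_arcs_def D)
    then have "in_degree (with_proj D) z = card {y \<in> ?N. w y z = 1}"
      unfolding in_degree_def by (simp add: card_image inj_on_def)
    also have "\<dots> = (\<Sum>y\<in>?N. if w y z = 1 then 1 else 0)"
      using finite_verts by (simp add: sum.If_cases Int_def)
    also have "\<dots> = (\<Sum>y\<in>?N. w y z)" using edge by (intro sum.cong) fastforce+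
    also have "\<dots> = d z"
      using sol that unfolding T.solution_def by (auto simp: vert_ok_def)
    finally show ?thesis using sol that by (auto simp: T.solution_def)
  qed
  have "orientation D G"
    unfolding orientation_def D using edge arcs_symmetric by fastforce
  moreover have "in_degree (with_proj D) x \<noteq> in_degree (with_proj D) y" if "(x, y) \<in> parcs G" for x y
    using deg[of x] deg[of y] edge[OF that] that wf by auto
  ultimately have "proper_orientation D G" by (auto simp: proper_orientation_def)
  then show ?thesis
    unfolding proper_orientation_number_def using deg by (intro Least_le) auto
qed

end
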